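(* Let $(\Omega,\mathcal F)$ be a measurable space, $\mathfrak P\subset\Delta(\mathcal F)$ nonempty, and let $(\mathcal X,\preceq,\|\cdot\|_{\mathcal X})$ be a Banach lattice such that $L^\infty_{\mathbf c}\subset\mathcal X\subset L^0_{\mathbf c}$ is an ideal. Then the following are equivalent: (1) $\mathfrak P$ is dominated. (2) $\mathcal X$ (with its norm topology) has the Kreps-Yan property.
   Context: $\Delta(\mathcal F)$ is the set of probability measures on $(\Omega,\mathcal F)$. Put $\mathbf c(A)=\sup_{\mathbb P\in\mathfrak P}\mathbb P(A)$ for $A\in\mathcal F$. A property holds $\mathfrak P$-quasi surely (q.s.) if it holds outside an event $A$ with $\mathbf c(A)=0$. $L^0_{\mathbf c}$ is the vector lattice of equivalence classes, up to $\mathfrak P$-q.s. equality, of real-valued random variables, ordered by $X\preceq Y$ iff $f\le g$ $\mathfrak P$-q.s. for representatives $f\in X,g\in Y$. $L^\infty_{\mathbf c}=\{X\in L^0_{\mathbf c}\mid\exists m>0:\ |X|\preceq m\mathbf 1_\Omega\}$. $\mathcal X$ carries the order of $L^0_{\mathbf c}$; an ideal is a vector subspace $\mathcal B$ such that $|x|\preceq|y|$ and $y\in\mathcal B$ imply $x\in\mathcal B$. $\mathfrak P$ is dominated if there is a probability measure $\mathbb P^*$ on $(\Omega,\mathcal F)$ such that $\mathbb P^*(N)=0$ implies $\mathbf c(N)=0$ for all $N\in\mathcal F$. Kreps-Yan property: Let $\mathcal X$ be a vector lattice with positive cone $\mathcal X_+$ and $\tau$ a locally convex-solid Hausdorff topology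 on $\mathcal X$. $(\mathcal X,\tau)$ has the Kreps-Yan property if for all convex cones $\mathcal C\subset\mathcal X$ with $-\mathcal X_+\subset\mathcal C$ and $\overline{\mathcal C}\cap\mathcal X_+=\{0\}$ (where $\overline{\mathcal C}$ is the $\tau$-closure), there is a strictly positive functional $\xi\in(\mathcal X,\tau)^*$ (i.e. $\xi(x)>0$ for all $x\in\mathcal X_+\setminus\{0\}$) such that $\xi(x)\le0$ for all $x\in\mathcal C$. *)

theory Defs
  imports "HOL-Probability.Probability" "HOL-Algebra.Lattice"
begin

record 'v ordered_space = "'v gorder" +
  vplus :: "'v \<Rightarrow> 'v \<Rightarrow> 'v" (infixl \<open>\<oplus>\<index>\<close> 65)
  vzero :: 'v (\<open>\<zero>\<index>\<close>)
  vscale :: "real \<Rightarrow> 'v \<Rightarrow> 'v" (infixr \<open>\<odot>\<index>\<close> 75)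

definition vminus :: "('v, 'm) ordered_space_scheme \<Rightarrow> 'v \<Rightarrow> 'v \<Rightarrow> 'v" (infixl \<open>\<ominus>\<index>\<close> 65) where
  "x \<ominus>\<^bsub>L\<^esub> y = x \<oplus>\<^bsub>L\<^esub> (-1) \<odot>\<^bsub>L\<^esub> y"

definition vabs :: "('v, 'm) ordered_space_scheme \<Rightarrow> 'v \<Rightarrow> 'v" where
  "vabs L x = x \<squnion>\<^bsub>L\<^esub> (-1) \<odot>\<^bsub>L\<^esub> x"

definition pos_cone :: "('v, 'm) ordered_space_scheme \<Rightarrow> 'v set" where
  "pos_cone L = {x \<in> carrier L. \<zero>\<^bsub>L\<^esub> \<sqsubseteq>\<^bsub>L\<^esub> x}"

locale vector_lattice = lattice L for L :: "('v, 'm) ordered_space_scheme" (structure) +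
  assumes plus_closed: "\<lbrakk>x \<in> carrier L; y \<in> carrier L\<rbrakk> \<Longrightarrow> x \<oplus> y \<in> carrier L"
    and zero_closed: "\<zero> \<in> carrier L"
    and scale_closed: "x \<in> carrier L \<Longrightarrow> t \<odot> x \<in> carrier L"
    and plus_assoc: "\<lbrakk>x \<in> carrier L; y \<in> carrier L; z \<in> carrier L\<rbrakk> \<Longrightarrow> (x \<oplus> y) \<oplus> z = x \<oplus> (y \<oplus> z)"
    and plus_commute: "\<lbrakk>x \<in> carrier L; y \<in> carrier L\<rbrakk> \<Longrightarrow> x \<oplus> y = y \<oplus> x"
    and plus_zero: "x \<in> carrier L \<Longrightarrow> x \<oplus> \<zero> = x"
    and plus_inverse: "x \<in> carrier L \<Longrightarrow> x \<ominus> x = \<zero>"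
    and scale_plus: "\<lbrakk>x \<in> carrier L; y \<in> carrier L\<rbrakk> \<Longrightarrow> t \<odot> (x \<oplus> y) = t \<odot> x \<oplus> t \<odot> y"
    and plus_scale: "x \<in> carrier L \<Longrightarrow> (s + t) \<odot> x = s \<odot> x \<oplus> t \<odot> x"
    and scale_scale: "x \<in> carrier L \<Longrightarrow> s \<odot> t \<odot> x = (s * t) \<odot> x"
    and scale_one: "x \<in> carrier L \<Longrightarrow> 1 \<odot> x = x"
    and plus_mono: "\<lbrakk>x \<in> carrier L; y \<in> carrier L; z \<in> carrier L; x \<sqsubseteq> y\<rbrakk> \<Longrightarrow> x \<oplus> z \<sqsubseteq> y \<oplus> z"
    and scale_mono: "\<lbrakk>x \<in> carrier L; y \<in> carrier L; x \<sqsubseteq> y; 0 \<le> t\<rbrakk> \<Longrightarrow> t \<odot> x \<sqsubseteq> t \<odot> y"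

definition lattice_ideal :: "('v, 'm) ordered_space_scheme \<Rightarrow> 'v set \<Rightarrow> bool" where
  "lattice_ideal L B \<longleftrightarrow>
     B \<subseteq> carrier L \<and> \<zero>\<^bsub>L\<^esub> \<in> B \<and>
     (\<forall>x\<in>B. \<forall>y\<in>B. x \<oplus>\<^bsub>L\<^esub> y \<in> B) \<and> (\<forall>t. \<forall>x\<in>B. t \<odot>\<^bsub>L\<^esub> x \<in> B) \<and>
     (\<forall>x\<in>carrier L. \<forall>y\<in>B. vabs L x \<sqsubseteq>\<^bsub>L\<^esub> vabs L y \<longrightarrow> x \<in> B)"

text \<open>The value 0 off the carrier is there only because \<^locale>\<open>Metric_space\<close> requires distances
  to be nonnegative and symmetric on the whole type.\<close>

definition norm_dist :: "('v, 'm) ordered_space_scheme \<Rightarrow> ('v \<Rightarrow> real) \<Rightarrow> 'v \<Rightarrow> 'v \<Rightarrow> real" where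
  "norm_dist L N x y = (if x \<in> carrier L \<and> y \<in> carrier L then N (x \<ominus>\<^bsub>L\<^esub> y) else 0)"

definition norm_topology :: "('v, 'm) ordered_space_scheme \<Rightarrow> ('v \<Rightarrow> real) \<Rightarrow> 'v topology" where
  "norm_topology L N = Metric_space.mtopology (carrier L) (norm_dist L N)"

locale banach_lattice = vector_lattice L for L :: "('v, 'm) ordered_space_scheme" (structure) +
  fixes N :: "'v \<Rightarrow> real"
  assumes norm_nonneg: "x \<in> carrier L \<Longrightarrow> 0 \<le> N x"
    and norm_eq_0: "x \<in> carrier L \<Longrightarrow> N x = 0 \<longleftrightarrow> x = \<zero>"
    and norm_triangle: "\<lbrakk>x \<in> carrier L; y \<in> carrier L\<rbrakk> \<Longrightarrow> N (x \<oplus> y) \<le> N x + N y"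
    and norm_scale: "x \<in> carrier L \<Longrightarrow> N (t \<odot> x) = \<bar>t\<bar> * N x"
    and norm_mono: "\<lbrakk>x \<in> carrier L; y \<in> carrier L; vabs L x \<sqsubseteq> vabs L y\<rbrakk> \<Longrightarrow> N x \<le> N y"
    and norm_complete: "Metric_space.mcomplete (carrier L) (norm_dist L N)"

text \<open>Locally convex-solid means that zero has a neighbourhood base of sets that are convex and
  solid.\<close>

locale locally_convex_solid = vector_lattice L for L :: "('v, 'm) ordered_space_scheme" (structure) +
  fixes T :: "'v topology"
  assumes topspace_eq: "topspace T = carrier L"
    and Hausdorff: "Hausdorff_space T"
    and continuous_plus: "continuous_map (prod_topology T T) T (\<lambda>(x, y). x \<oplus> y)"
    and continuous_scale: "continuous_map (prod_topology euclideanreal T) T (\<lambda>(t, x). t \<odot> x)"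
    and convex_solid_base:
      "\<lbrakk>openin T U; \<zero> \<in> U\<rbrakk> \<Longrightarrow>
         \<exists>V W. openin T W \<and> \<zero> \<in> W \<and> W \<subseteq> V \<and> V \<subseteq> U \<and>
           (\<forall>x\<in>V. \<forall>y\<in>V. \<forall>t\<in>{0..1}. (1 - t) \<odot> x \<oplus> t \<odot> y \<in> V) \<and>
           (\<forall>x\<in>carrier L. \<forall>y\<in>V. vabs L x \<sqsubseteq> vabs L y \<longrightarrow> x \<in> V)"
begin

definition convex_cone_in :: "'v set \<Rightarrow> bool" where
  "convex_cone_in C \<longleftrightarrow> C \<subseteq> carrier L \<and> C \<noteq> {} \<and>
     (\<forall>x\<in>C. \<forall>y\<in>C. x \<oplus> y \<in> C) \<and> (\<forall>t\<ge>0. \<forall>x\<in>C. t \<odot> x \<in> C)"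

text \<open>Only the values on the carrier matter for a functional.\<close>

definition topological_dual :: "('v \<Rightarrow> real) set" where
  "topological_dual = {\<xi>. continuous_map T euclideanreal \<xi> \<and>
     (\<forall>x\<in>carrier L. \<forall>y\<in>carrier L. \<xi> (x \<oplus> y) = \<xi> x + \<xi> y) \<and>
     (\<forall>t. \<forall>x\<in>carrier L. \<xi> (t \<odot> x) = t * \<xi> x)}"

definition strictly_positive :: "('v \<Rightarrow> real) \<Rightarrow> bool" where
  "strictly_positive \<xi> \<longleftrightarrow> (\<forall>x\<in>pos_cone L - {\<zero>}. 0 < \<xi> x)"

definition kreps_yan :: bool where
  "kreps_yan \<longleftrightarrow>
     (\<forall>C. convex_cone_in C \<and> (\<lambda>x. (-1) \<odot> x) ` pos_cone L \<subseteq> C \<and>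
          (T closure_of C) \<inter> pos_cone L = {\<zero>} \<longrightarrow>
        (\<exists>\<xi>\<in>topological_dual. strictly_positive \<xi> \<and> (\<forall>x\<in>C. \<xi> x \<le> 0)))"

end

text \<open>The norm topology of a Banach lattice is locally convex-solid, so that
  \<^const>\<open>locally_convex_solid.kreps_yan\<close> may be applied to it.\<close>

context vector_lattice
begin

lemma vminus_closed: "\<lbrakk>x \<in> carrier L; y \<in> carrier L\<rbrakk> \<Longrightarrow> x \<ominus> y \<in> carrier L"
  by (simp add: vminus_def plus_closed scale_closed)

lemma zero_plus: "x \<in> carrier L \<Longrightarrow> \<zero> \<oplus> x = x"
  by (metis plus_commute plus_zero zero_closed)

lemma plus_left_commute:
  "\<lbrakk>x \<in> carrier L; y \<in> carrier L; z \<in> carrier L\<rbrakk> \<Longrightarrow> x \<oplus> (y \<oplus> z) = y \<oplus> (x \<oplus> z)"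
  by (metis plus_assoc plus_commute)

lemmas plus_ac = plus_assoc plus_commute plus_left_commute

lemma plus_uminus: "x \<in> carrier L \<Longrightarrow> x \<oplus> (-1) \<odot> x = \<zero>"
  using plus_inverse by (simp add: vminus_def)

lemma plus_uminus_cancel:
  assumes "x \<in> carrier L" "y \<in> carrier L"
  shows "x \<oplus> ((-1) \<odot> x \<oplus> y) = y" and "(-1) \<odot> x \<oplus> (x \<oplus> y) = y"
proof -
  show "x \<oplus> ((-1) \<odot> x \<oplus> y) = y"
    using assms by (metis plus_assoc plus_uminus zero_plus scale_closed)
  then show "(-1) \<odot> x \<oplus> (x \<oplus> y) = y"
    using assms by (metis plus_left_commute scale_closed)
qed

lemma vminus_plus_cancel: "\<lbrakk>x \<in> carrier L; y \<in> carrier L\<rbrakk> \<Longrightarrow> (x \<ominus> y) \<oplus> y = x"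
  unfolding vminus_def by (metis plus_assoc plus_commute plus_uminus plus_zero scale_closed)

lemma vminus_eq_zero_iff: "\<lbrakk>x \<in> carrier L; y \<in> carrier L\<rbrakk> \<Longrightarrow> x \<ominus> y = \<zero> \<longleftrightarrow> x = y"
  by (metis plus_inverse vminus_plus_cancel zero_plus)

lemma vminus_zero: "x \<in> carrier L \<Longrightarrow> x \<ominus> \<zero> = x"
  by (metis plus_zero vminus_closed vminus_plus_cancel zero_closed)

lemma scale_uminus_uminus: "x \<in> carrier L \<Longrightarrow> (-1) \<odot> (-1) \<odot> x = x"
  by (simp add: scale_scale scale_one)

lemma vminus_swap: "\<lbrakk>x \<in> carrier L; y \<in> carrier L\<rbrakk> \<Longrightarrow> x \<ominus> y = (-1) \<odot> (y \<ominus> x)"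
  unfolding vminus_def
  by (metis plus_commute scale_closed scale_plus scale_uminus_uminus)

lemma vminus_trans:
  "\<lbrakk>x \<in> carrier L; y \<in> carrier L; z \<in> carrier L\<rbrakk> \<Longrightarrow> x \<ominus> z = (x \<ominus> y) \<oplus> (y \<ominus> z)"
  unfolding vminus_def
  by (simp add: plus_ac scale_closed plus_closed plus_uminus_cancel)

lemma plus_vminus_plus:
  "\<lbrakk>x \<in> carrier L; y \<in> carrier L; x' \<in> carrier L; y' \<in> carrier L\<rbrakk>
   \<Longrightarrow> (x \<oplus> y) \<ominus> (x' \<oplus> y') = (x \<ominus> x') \<oplus> (y \<ominus> y')"
  unfolding vminus_def
  by (simp add: plus_ac scale_closed plus_closed scale_plus)

lemma scale_vminus:
  "\<lbrakk>x \<in> carrier L; y \<in> carrier L\<rbrakk> \<Longrightarrow> s \<odot> (x \<ominus> y) = s \<odot> x \<ominus> s \<odot> y"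
  by (simp add: vminus_def scale_plus scale_closed scale_scale)

lemma scale_vminus_scale:
  assumes "x \<in> carrier L" "y \<in> carrier L"
  shows "s \<odot> x \<ominus> t \<odot> y = s \<odot> (x \<ominus> y) \<oplus> (s - t) \<odot> y"
proof -
  have "(s - t) \<odot> y = s \<odot> y \<ominus> t \<odot> y"
    using plus_scale[of y s "- t"] assms by (simp add: vminus_def scale_scale)
  then show ?thesis
    using assms by (metis scale_vminus vminus_trans scale_closed)
qed

end

context banach_lattice
begin

lemma Metric_space_norm_dist: "Metric_space (carrier L) (norm_dist L N)"
proof
  show "0 \<le> norm_dist L N x y" for x y
    by (simp add: norm_dist_def norm_nonneg vminus_closed)
  have "N (x \<ominus> y) = N (y \<ominus> x)" if "x \<in> carrier L" "y \<in> carrier L" for x y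
    using that by (subst vminus_swap) (simp_all add: norm_scale vminus_closed)
  then show "norm_dist L N x y = norm_dist L N y x" for x y
    by (auto simp: norm_dist_def)
  show "norm_dist L N x y = 0 \<longleftrightarrow> x = y" if "x \<in> carrier L" "y \<in> carrier L" for x y
    using that by (simp add: norm_dist_def norm_eq_0 vminus_closed vminus_eq_zero_iff)
  show "norm_dist L N x z \<le> norm_dist L N x y + norm_dist L N y z"
    if "x \<in> carrier L" "y \<in> carrier L" "z \<in> carrier L" for x y z
    using that by (simp add: norm_dist_def vminus_trans[of x y z] norm_triangle vminus_closed)
qed

sublocale norm: Metric_space "carrier L" "norm_dist L N"
  by (fact Metric_space_norm_dist)

lemma norm_topology_eq: "norm_topology L N = norm.mtopology"
  by (simp add: norm_topology_def)

lemma in_mball: "y \<in> norm.mball x r \<longleftrightarrow> x \<in> carrier L \<and> y \<in> carrier L \<and> N (y \<ominus> x) < r"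
  by (auto simp: norm.commute[of x y]) (auto simp: norm_dist_def)

lemma continuous_map_norm_plus:
  "continuous_map (prod_topology (norm_topology L N) (norm_topology L N)) (norm_topology L N)
     (\<lambda>(x, y). x \<oplus> y)"
  unfolding norm_topology_eq norm.continuous_map_to_metric
proof (intro ballI allI impI)
  fix p and e :: real assume p: "p \<in> topspace (prod_topology norm.mtopology norm.mtopology)" and e: "0 < e"
  obtain a b where [simp]: "p = (a, b)" by (cases p)
  have ab: "a \<in> carrier L" "b \<in> carrier L" using p by auto
  let ?U = "norm.mball a (e/2) \<times> norm.mball b (e/2)"
  have "case q of (x, y) \<Rightarrow> x \<oplus> y \<in> norm.mball (case p of (x, y) \<Rightarrow> x \<oplus> y) e" if "q \<in> ?U" for q
  proof -
    obtain x y where [simp]: "q = (x, y)" by (cases q)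
    have xy: "x \<in> carrier L" "y \<in> carrier L" "N (x \<ominus> a) < e/2" "N (y \<ominus> b) < e/2"
      using that by (auto simp only: \<open>q = (x, y)\<close> mem_Sigma_iff in_mball)
    have "N ((x \<oplus> y) \<ominus> (a \<oplus> b)) < e"
      using norm_triangle[of "x \<ominus> a" "y \<ominus> b"] xy ab by (simp add: plus_vminus_plus vminus_closed)
    then show ?thesis using xy ab by (simp add: in_mball plus_closed del: norm.in_mball)
  qed
  moreover have "openin (prod_topology norm.mtopology norm.mtopology) ?U"
    by (simp add: openin_prod_Times_iff)
  moreover have "p \<in> ?U" using ab e by simp
  ultimately show "\<exists>U. openin (prod_topology norm.mtopology norm.mtopology) U \<and> p \<in> U \<and>
      (\<forall>q\<in>U. (case q of (x, y) \<Rightarrow> x \<oplus> y) \<in> norm.mball (case p of (x, y) \<Rightarrow> x \<oplus> y) e)"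
    by (intro exI[of _ ?U]) (auto simp del: norm.in_mball)
qed

lemma continuous_map_norm_scale:
  "continuous_map (prod_topology euclideanreal (norm_topology L N)) (norm_topology L N)
     (\<lambda>(t, x). t \<odot> x)"
  unfolding norm_topology_eq norm.continuous_map_to_metric
proof (intro ballI allI impI)
  fix p and e :: real assume p: "p \<in> topspace (prod_topology euclideanreal norm.mtopology)" and e: "0 < e"
  obtain s a where [simp]: "p = (s, a)" by (cases p)
  have a: "a \<in> carrier L" using p by auto
  define d where "d = min 1 (e / (2 * (\<bar>s\<bar> + 1)))"
  define d' where "d' = e / (2 * (N a + 1))"
  have pos: "0 < d" "0 < d'"
    using e norm_nonneg[OF a] by (auto simp: d_def d'_def intro!: divide_pos_pos)
  define r where "r = min 1 d'"
  define dd where "dd = e / (2 * (\<bar>s\<bar> + 1))"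
  have r: "0 < r" "0 < dd" using pos e by (auto simp: r_def dd_def intro!: divide_pos_pos)
  let ?U = "ball s r \<times> norm.mball a dd"
  have "case q of (t, x) \<Rightarrow> t \<odot> x \<in> norm.mball (case p of (t, x) \<Rightarrow> t \<odot> x) e" if "q \<in> ?U" for q
  proof -
    obtain t x where [simp]: "q = (t, x)" by (cases q)
    have x: "x \<in> carrier L" "N (x \<ominus> a) < dd" "\<bar>t - s\<bar> < r"
      using that by (auto simp only: \<open>q = (t, x)\<close> mem_Sigma_iff in_mball mem_ball dist_real_def)
    have "N (t \<odot> x \<ominus> s \<odot> a) \<le> \<bar>t\<bar> * N (x \<ominus> a) + \<bar>t - s\<bar> * N a"
      using norm_triangle[of "t \<odot> (x \<ominus> a)" "(t - s) \<odot> a"] x a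
      by (simp add: scale_vminus_scale vminus_closed scale_closed norm_scale)
    also have "\<bar>t\<bar> * N (x \<ominus> a) < e / 2"
    proof -
      have "\<bar>t\<bar> * N (x \<ominus> a) \<le> (\<bar>s\<bar> + 1) * N (x \<ominus> a)"
        using x a by (intro mult_right_mono norm_nonneg vminus_closed) (auto simp: r_def)
      also have "\<dots> < (\<bar>s\<bar> + 1) * dd"
        using x by (intro mult_strict_left_mono) auto
      also have "\<dots> = e / 2" by (simp add: dd_def field_simps)
      finally show ?thesis .
    qed
    also have "\<bar>t - s\<bar> * N a \<le> d' * (N a + 1)"
      using x norm_nonneg[OF a] pos by (intro mult_mono) (auto simp: r_def)
    also have "\<dots> = e / 2" using norm_nonneg[OF a] by (simp add: d'_def field_simps)
    finally have "N (t \<odot> x \<ominus> s \<odot> a) < e" by simp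
    then show ?thesis using x a by (simp add: in_mball scale_closed del: norm.in_mball)
  qed
  moreover have "openin (prod_topology euclideanreal norm.mtopology) ?U"
    by (simp add: openin_prod_Times_iff)
  moreover have "p \<in> ?U" using a r by simp
  ultimately show "\<exists>U. openin (prod_topology euclideanreal norm.mtopology) U \<and> p \<in> U \<and>
      (\<forall>q\<in>U. (case q of (t, x) \<Rightarrow> t \<odot> x) \<in> norm.mball (case p of (t, x) \<Rightarrow> t \<odot> x) e)"
    by (intro exI[of _ ?U]) (auto simp del: norm.in_mball)
qed

lemma locally_convex_solid_norm_topology: "locally_convex_solid L (norm_topology L N)"
proof
  show "topspace (norm_topology L N) = carrier L" by (simp add: norm_topology_eq)
  show "Hausdorff_space (norm_topology L N)"
    by (simp add: norm_topology_eq norm.Hausdorff_space_mtopology)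
  fix U assume "openin (norm_topology L N) U" "\<zero> \<in> U"
  then obtain r where r: "0 < r" "norm.mball \<zero> r \<subseteq> U"
    by (auto simp: norm_topology_eq norm.openin_mtopology)
  let ?V = "norm.mball \<zero> r"
  have V: "x \<in> ?V \<longleftrightarrow> x \<in> carrier L \<and> N x < r" for x
    by (auto simp: in_mball zero_closed vminus_zero simp del: norm.in_mball)
  have "(1 - t) \<odot> x \<oplus> t \<odot> y \<in> ?V" if "x \<in> ?V" "y \<in> ?V" "t \<in> {0..1}" for x y t
  proof -
    have xy: "x \<in> carrier L" "N x < r" "y \<in> carrier L" "N y < r" using that V by blast+
    have "N ((1 - t) \<odot> x \<oplus> t \<odot> y) \<le> (1 - t) * N x + t * N y"
      using norm_triangle[of "(1 - t) \<odot> x" "t \<odot> y"] xy that(3) by (simp add: scale_closed norm_scale)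
    also have "\<dots> < r"
      using xy that(3) by (intro convex_bound_lt) auto
    finally show ?thesis using xy by (simp add: V plus_closed scale_closed del: norm.in_mball)
  qed
  moreover have "x \<in> ?V" if "x \<in> carrier L" "y \<in> ?V" "vabs L x \<sqsubseteq> vabs L y" for x y
    using that norm_mono[of x y] unfolding V by auto
  moreover have "openin (norm_topology L N) ?V" "\<zero> \<in> ?V"
    using r by (simp_all add: norm_topology_eq zero_closed)
  ultimately show "\<exists>V W. openin (norm_topology L N) W \<and> \<zero> \<in> W \<and> W \<subseteq> V \<and> V \<subseteq> U \<and>
      (\<forall>x\<in>V. \<forall>y\<in>V. \<forall>t\<in>{0..1}. (1 - t) \<odot> x \<oplus> t \<odot> y \<in> V) \<and>
      (\<forall>x\<in>carrier L. \<forall>y\<in>V. vabs L x \<sqsubseteq> vabs L y \<longrightarrow> x \<in> V)"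
    using r(2) by (intro exI[of _ ?V]) (auto simp del: norm.in_mball)
qed (fact continuous_map_norm_plus continuous_map_norm_scale)+

end

text \<open>Only the \<open>\<sigma>\<close>-algebra of the measure space \<open>M\<close> is used below;
  \<open>P\<close> is the set of priors.\<close>

definition upper_prob :: "'a measure set \<Rightarrow> 'a set \<Rightarrow> ennreal" where
  "upper_prob P A = (SUP Q\<in>P. emeasure Q A)"

definition quasi_surely :: "'a measure \<Rightarrow> 'a measure set \<Rightarrow> ('a \<Rightarrow> bool) \<Rightarrow> bool" where
  "quasi_surely M P R \<longleftrightarrow>
     (\<exists>A\<in>sets M. upper_prob P A = 0 \<and> (\<forall>\<omega>\<in>space M - A. R \<omega>))"

definition qs_eq :: "'a measure \<Rightarrow> 'a measure set \<Rightarrow> ('a \<Rightarrow> real) rel" where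
  "qs_eq M P = {(f, g). f \<in> borel_measurable M \<and> g \<in> borel_measurable M \<and>
     quasi_surely M P (\<lambda>\<omega>. f \<omega> = g \<omega>)}"

definition qs_class :: "'a measure \<Rightarrow> 'a measure set \<Rightarrow> ('a \<Rightarrow> real) \<Rightarrow> ('a \<Rightarrow> real) set" where
  "qs_class M P f = qs_eq M P `` {f}"

definition L0 :: "'a measure \<Rightarrow> 'a measure set \<Rightarrow> ('a \<Rightarrow> real) set ordered_space" where
  "L0 M P =
     \<lparr>carrier = borel_measurable M // qs_eq M P,
      eq = (=),
      le = (\<lambda>X Y. \<exists>f\<in>X. \<exists>g\<in>Y. quasi_surely M P (\<lambda>\<omega>. f \<omega> \<le> g \<omega>)),
      vplus = (\<lambda>X Y. \<Union>f\<in>X. \<Union>g\<in>Y. qs_class M P (\<lambda>\<omega>. f \<omega> + g \<omega>)),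
      vzero = qs_class M P (\<lambda>\<omega>. 0),
      vscale = (\<lambda>t X. \<Union>f\<in>X. qs_class M P (\<lambda>\<omega>. t * f \<omega>))\<rparr>"

definition Linfty :: "'a measure \<Rightarrow> 'a measure set \<Rightarrow> ('a \<Rightarrow> real) set set" where
  "Linfty M P = {X \<in> carrier (L0 M P). \<exists>m>0.
     vabs (L0 M P) X \<sqsubseteq>\<^bsub>L0 M P\<^esub> m \<odot>\<^bsub>L0 M P\<^esub> qs_class M P (indicat_real (space M))}"

definition dominated :: "'a measure \<Rightarrow> 'a measure set \<Rightarrow> bool" where
  "dominated M P \<longleftrightarrow>
     (\<exists>Q\<in>space (prob_algebra M). \<forall>A\<in>sets M. emeasure Q A = 0 \<longrightarrow> upper_prob P A = 0)"

end

theory Submission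
  imports Defs
begin

text \<open>
  Both directions rest on a Halmos-Savage exhaustion: if a finitely additive \<open>\<mu> \<ge> 0\<close> on the
  \<open>\<sigma>\<close>-algebra vanishes only on sets that are null for every prior, then countably many
  priors have the same common null sets as all of them, and a mixture of these has exactly the
  quasi-sure null sets.

  Given the Kreps-Yan property, apply it to the negative cone, which is norm closed, and use
  \<open>\<mu> A = \<xi> (1\<^sub>A)\<close> for the resulting functional \<open>\<xi>\<close>; since \<open>\<xi>\<close> need not be order continuous,
  \<open>\<mu>\<close> is in general only finitely additive.

  Conversely, let \<open>Q\<close> be a probability measure with the quasi-sure null sets and \<open>C\<close> a cone as in
  the Kreps-Yan property. For \<open>\<epsilon> > 0\<close> the convex set of all \<open>0 \<le> f \<le> 1\<close> with \<open>\<integral>f dQ \<ge> \<epsilon>\<close> has positive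
  distance from \<open>C\<close>: otherwise take elements \<open>g\<^sub>i\<close> of this set that almost minimise \<open>\<integral>g\<^sup>2 dQ\<close> subject to
  being within \<open>2\<^sup>-\<^sup>i\<close> of \<open>C\<close>. By the parallelogram law they converge uniformly off a set of small
  measure, and the limit, cut off to \<open>0\<close> there, is a nonzero positive element of the closure of \<open>C\<close>.
  Hahn-Banach then separates this set from \<open>C\<close>, and a weighted sum of the functionals
  obtained for \<open>\<epsilon> = 1/(n+1)\<close> is strictly positive.
\<close>

section \<open>Hahn-Banach in vector lattices\<close>

context vector_lattice
begin

definition sublinear :: "('v \<Rightarrow> real) \<Rightarrow> bool" where
  "sublinear q \<longleftrightarrow> (\<forall>x\<in>carrier L. \<forall>y\<in>carrier L. q (x \<oplus> y) \<le> q x + q y) \<and>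
     (\<forall>t\<ge>0. \<forall>x\<in>carrier L. q (t \<odot> x) = t * q x)"

definition linear_functional :: "('v \<Rightarrow> real) \<Rightarrow> bool" where
  "linear_functional \<xi> \<longleftrightarrow> (\<forall>x\<in>carrier L. \<forall>y\<in>carrier L. \<xi> (x \<oplus> y) = \<xi> x + \<xi> y) \<and>
     (\<forall>t. \<forall>x\<in>carrier L. \<xi> (t \<odot> x) = t * \<xi> x)"

lemma zero_scale: "x \<in> carrier L \<Longrightarrow> 0 \<odot> x = \<zero>"
  using plus_scale[of x 1 "-1"] by (simp add: scale_one plus_uminus)

lemma scale_zero: "t \<odot> \<zero> = \<zero>"
  using scale_scale[of \<zero> t 0] by (simp add: zero_scale zero_closed)

lemma sublinear_add: "\<lbrakk>sublinear q; x \<in> carrier L; y \<in> carrier L\<rbrakk> \<Longrightarrow> q (x \<oplus> y) \<le> q x + q y"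
  by (simp add: sublinear_def)

lemma sublinear_scale: "\<lbrakk>sublinear q; 0 \<le> t; x \<in> carrier L\<rbrakk> \<Longrightarrow> q (t \<odot> x) = t * q x"
  by (simp add: sublinear_def)

lemma sublinear_zero: "sublinear q \<Longrightarrow> q \<zero> = 0"
  using sublinear_scale[of q 0 \<zero>] by (simp add: zero_scale zero_closed)

lemma sublinear_uminus_le: "\<lbrakk>sublinear q; x \<in> carrier L\<rbrakk> \<Longrightarrow> - q ((-1) \<odot> x) \<le> q x"
  using sublinear_add[of q x "(-1) \<odot> x"] by (simp add: plus_uminus sublinear_zero scale_closed)

text \<open>A pair \<open>(y, s)\<close> encodes the constraint \<open>s \<le> \<xi> y\<close> on a functional \<open>\<xi>\<close>.\<close>

definition half_space_cone :: "('v \<times> real) set \<Rightarrow> bool" where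
  "half_space_cone E \<longleftrightarrow> E \<subseteq> carrier L \<times> UNIV \<and> (\<zero>, 0) \<in> E \<and>
     (\<forall>y s y' s'. (y, s) \<in> E \<longrightarrow> (y', s') \<in> E \<longrightarrow> (y \<oplus> y', s + s') \<in> E) \<and>
     (\<forall>t y s. 0 \<le> t \<longrightarrow> (y, s) \<in> E \<longrightarrow> (t \<odot> y, t * s) \<in> E)"

text \<open>The witness is the infimum of \<open>q (x \<oplus> y) - s\<close> over all constraints
  \<open>(y, s)\<close> in \<open>E\<close>; it is sublinear because \<open>E\<close> is a convex
  cone. Any linear functional below it satisfies every constraint, as
  \<open>x = (-1) \<odot> y\<close> shows.\<close>

lemma sublinear_reduction:
  assumes q: "sublinear q" and E: "half_space_cone E" and le: "\<And>y s. (y, s) \<in> E \<Longrightarrow> s \<le> q y"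
  shows "\<exists>p. sublinear p \<and> (\<forall>x\<in>carrier L. \<forall>(y, s)\<in>E. p x \<le> q (x \<oplus> y) - s)"
proof -
  define p where "p x = (INF (y, s)\<in>E. q (x \<oplus> y) - s)" for x
  have Ec: "y \<in> carrier L" if "(y, s) \<in> E" for y s
    using that E by (auto simp: half_space_cone_def)
  have E0: "(\<zero>, 0) \<in> E" using E by (simp add: half_space_cone_def)
  \<comment> \<open>This bound does not depend on the constraint, so the infimum in \<open>p\<close>
    is a genuine one. It comes from subadditivity together with \<open>s \<le> q y\<close>.\<close>
  have lower: "- q ((-1) \<odot> x) \<le> q (x \<oplus> y) - s" if "x \<in> carrier L" "(y, s) \<in> E" for x y s
  proof -
    have "q ((-1) \<odot> x \<oplus> (x \<oplus> y)) \<le> q ((-1) \<odot> x) + q (x \<oplus> y)"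
      using that Ec by (intro sublinear_add[OF q]) (auto simp: scale_closed plus_closed)
    then show ?thesis
      using le[OF that(2)] Ec[OF that(2)] that(1) by (simp add: plus_uminus_cancel)
  qed
  then have bdd: "bdd_below ((\<lambda>(y, s). q (x \<oplus> y) - s) ` E)" if "x \<in> carrier L" for x
    using that by (intro bdd_belowI2[of _ "- q ((-1) \<odot> x)"]) auto
  have p_le: "p x \<le> q (x \<oplus> y) - s" if "x \<in> carrier L" "(y, s) \<in> E" for x y s
    unfolding p_def using cINF_lower[OF bdd[OF that(1)] that(2)] by simp
  have p_ge: "b \<le> p x" if "\<And>y s. (y, s) \<in> E \<Longrightarrow> b \<le> q (x \<oplus> y) - s" for b x
    unfolding p_def using that E0 by (intro cINF_greatest) auto
  have add: "p (x \<oplus> x') \<le> p x + p x'" if x: "x \<in> carrier L" "x' \<in> carrier L" for x x'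
  proof -
    have *: "p (x \<oplus> x') \<le> (q (x \<oplus> y) - s) + (q (x' \<oplus> y') - s')"
      if yE: "(y, s) \<in> E" "(y', s') \<in> E" for y s y' s'
    proof -
      have "(y \<oplus> y', s + s') \<in> E" using E yE by (simp add: half_space_cone_def)
      then have "p (x \<oplus> x') \<le> q ((x \<oplus> x') \<oplus> (y \<oplus> y')) - (s + s')"
        using x by (intro p_le) (auto simp: plus_closed)
      also have "(x \<oplus> x') \<oplus> (y \<oplus> y') = (x \<oplus> y) \<oplus> (x' \<oplus> y')"
        using x yE[THEN Ec] by (simp add: plus_ac plus_closed)
      also have "q \<dots> \<le> q (x \<oplus> y) + q (x' \<oplus> y')"
        using x yE[THEN Ec] by (intro sublinear_add[OF q]) (auto simp: plus_closed)
      finally show ?thesis by simp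
    qed
    have "p (x \<oplus> x') - (q (x \<oplus> y) - s) \<le> p x'" if "(y, s) \<in> E" for y s
      using *[OF that] by (intro p_ge) (simp add: algebra_simps)
    then have "p (x \<oplus> x') - p x' \<le> p x"
      by (intro p_ge) (simp add: algebra_simps)
    then show ?thesis by simp
  qed
  have scale_le: "p (t \<odot> x) \<le> t * p x" if t: "0 < t" and x: "x \<in> carrier L" for t x
  proof -
    have "p (t \<odot> x) / t \<le> p x"
    proof (rule p_ge)
      fix y s assume yE: "(y, s) \<in> E"
      have "(t \<odot> y, t * s) \<in> E" using E yE t by (simp add: half_space_cone_def)
      then have "p (t \<odot> x) \<le> q (t \<odot> x \<oplus> t \<odot> y) - t * s"
        using x by (intro p_le) (auto simp: scale_closed)
      also have "t \<odot> x \<oplus> t \<odot> y = t \<odot> (x \<oplus> y)"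
        using x Ec[OF yE] by (simp add: scale_plus)
      also have "q \<dots> = t * q (x \<oplus> y)"
        using x Ec[OF yE] t by (intro sublinear_scale[OF q]) (auto simp: plus_closed)
      finally show "p (t \<odot> x) / t \<le> q (x \<oplus> y) - s"
        using t by (simp add: field_simps)
    qed
    then show ?thesis using t by (simp add: field_simps)
  qed
  have p0: "p \<zero> = 0"
  proof (rule antisym)
    show "p \<zero> \<le> 0"
      using p_le[OF zero_closed E0] by (simp add: plus_zero zero_closed sublinear_zero[OF q])
    show "0 \<le> p \<zero>" using le Ec by (intro p_ge) (simp add: zero_plus)
  qed
  have "p (t \<odot> x) = t * p x" if t: "0 \<le> t" and x: "x \<in> carrier L" for t x
  proof (cases "t = 0")
    case True
    then show ?thesis using x by (simp add: zero_scale p0)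
  next
    case False
    then have t: "0 < t" using t by simp
    \<comment> \<open>The reverse inequality is \<open>scale_le\<close> with the factor
      \<open>1 / t\<close> applied at \<open>t \<odot> x\<close>.\<close>
    have "p ((1 / t) \<odot> (t \<odot> x)) \<le> (1 / t) * p (t \<odot> x)"
      using t x by (intro scale_le) (auto simp: scale_closed)
    then have "t * p x \<le> p (t \<odot> x)"
      using t x by (simp add: scale_scale scale_one field_simps)
    then show ?thesis using scale_le[OF t x] by simp
  qed
  with add have "sublinear p" by (auto simp: sublinear_def)
  with p_le show ?thesis by blast
qed

text \<open>A pointwise infimum of sublinear functionals need not be subadditive; along a chain it
  is, since two members can be replaced by the smaller one. The common bound \<open>p\<close> keeps
  the infimum finite, because \<open>q x\<close> is at least \<open>- q ((-1) \<odot> x)\<close> and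
  hence at least \<open>- p ((-1) \<odot> x)\<close>.\<close>

lemma sublinear_chain_Inf:
  assumes "Q \<noteq> {}" and sub: "\<And>q. q \<in> Q \<Longrightarrow> sublinear q"
    and le: "\<And>q x. q \<in> Q \<Longrightarrow> x \<in> carrier L \<Longrightarrow> q x \<le> p x"
    and chain: "\<And>q q'. q \<in> Q \<Longrightarrow> q' \<in> Q \<Longrightarrow> (\<forall>x. q x \<le> q' x) \<or> (\<forall>x. q' x \<le> q x)"
  shows "sublinear (\<lambda>x. INF q\<in>Q. q x)"
    and "\<And>q x. q \<in> Q \<Longrightarrow> x \<in> carrier L \<Longrightarrow> (INF q\<in>Q. q x) \<le> q x"
proof -
  have bdd: "bdd_below ((\<lambda>q. q x) ` Q)" if x: "x \<in> carrier L" for x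
  proof (rule bdd_belowI2)
    fix q assume "q \<in> Q"
    then show "- p ((-1) \<odot> x) \<le> q x"
      using sublinear_uminus_le[OF sub x] le[of q "(-1) \<odot> x"] x by (force simp: scale_closed)
  qed
  show lower: "(INF q\<in>Q. q x) \<le> q x" if "q \<in> Q" "x \<in> carrier L" for q x
    using that bdd by (intro cINF_lower) auto
  have ge: "b \<le> (INF q\<in>Q. q x)" if "\<And>q. q \<in> Q \<Longrightarrow> b \<le> q x" for b x
    using that \<open>Q \<noteq> {}\<close> by (intro cINF_greatest) auto
  show "sublinear (\<lambda>x. INF q\<in>Q. q x)"
    unfolding sublinear_def
  proof (intro conjI ballI allI impI)
    fix x y assume x: "x \<in> carrier L" and y: "y \<in> carrier L"
    have *: "(INF q\<in>Q. q (x \<oplus> y)) \<le> q x + q' y" if q: "q \<in> Q" "q' \<in> Q" for q q'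
    proof -
      \<comment> \<open>The smaller of \<open>q\<close> and \<open>q'\<close> serves for both
        arguments.\<close>
      obtain r where "r \<in> Q" "r x \<le> q x" "r y \<le> q' y"
        using chain[OF q] q by blast
      then show ?thesis
        using lower[OF \<open>r \<in> Q\<close>, of "x \<oplus> y"] sublinear_add[OF sub x y, of r] x y
        by (simp add: plus_closed)
    qed
    have "(INF q\<in>Q. q (x \<oplus> y)) - q x \<le> (INF q\<in>Q. q y)" if "q \<in> Q" for q
      using *[OF that] by (intro ge) (simp add: algebra_simps)
    then have "(INF q\<in>Q. q (x \<oplus> y)) - (INF q\<in>Q. q y) \<le> (INF q\<in>Q. q x)"
      by (intro ge) (simp add: algebra_simps)
    then show "(INF q\<in>Q. q (x \<oplus> y)) \<le> (INF q\<in>Q. q x) + (INF q\<in>Q. q y)" by simp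
  next
    fix t :: real and x assume t: "0 \<le> t" and x: "x \<in> carrier L"
    have eq: "q (t \<odot> x) = t * q x" if "q \<in> Q" for q
      using sublinear_scale[OF sub t x] that .
    show "(INF q\<in>Q. q (t \<odot> x)) = t * (INF q\<in>Q. q x)"
    proof (cases "t = 0")
      case True
      then have "(INF q\<in>Q. q (t \<odot> x)) = (INF q\<in>Q. 0)"
        using eq by (intro INF_cong) auto
      then show ?thesis using True \<open>Q \<noteq> {}\<close> by simp
    next
      case False
      then have "0 < t" using t by simp
      show ?thesis
      proof (rule antisym)
        have "(INF q\<in>Q. q (t \<odot> x)) / t \<le> (INF q\<in>Q. q x)"
          using \<open>0 < t\<close> eq lower[of _ "t \<odot> x"] x
          by (intro ge) (auto simp: field_simps scale_closed)
        then show "(INF q\<in>Q. q (t \<odot> x)) \<le> t * (INF q\<in>Q. q x)"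
          using \<open>0 < t\<close> by (simp add: field_simps)
        show "t * (INF q\<in>Q. q x) \<le> (INF q\<in>Q. q (t \<odot> x))"
          proof (rule ge)
          fix q assume "q \<in> Q"
          then show "t * (INF q\<in>Q. q x) \<le> q (t \<odot> x)"
            using mult_left_mono[OF lower t] eq x by metis
        qed
      qed
    qed
  qed
qed

text \<open>Only superadditivity is at stake. For fixed \<open>y\<close>, reducing \<open>q\<close>
  by the ray through \<open>(y, q y)\<close> gives a sublinear \<open>p\<close> below
  \<open>q\<close> with \<open>p x \<le> q (x \<oplus> y) - q y\<close>; minimality allows
  \<open>p x\<close> to be replaced by \<open>q x\<close>. Additivity then extends homogeneity to
  negative factors.\<close>

lemma minimal_sublinear_linear:
  assumes q: "sublinear q"
    and min: "\<And>p. sublinear p \<Longrightarrow> (\<And>x. x \<in> carrier L \<Longrightarrow> p x \<le> q x) \<Longrightarrow>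
                (\<And>x. x \<in> carrier L \<Longrightarrow> q x \<le> p x)"
  shows "linear_functional q"
proof -
  have add: "q (x \<oplus> y) = q x + q y" if x: "x \<in> carrier L" and y: "y \<in> carrier L" for x y
  proof -
    define E where "E = (\<lambda>t. (t \<odot> y, t * q y)) ` {0..}"
    have E: "half_space_cone E"
      unfolding half_space_cone_def
    proof (intro conjI)
      show "E \<subseteq> carrier L \<times> UNIV" using y by (auto simp: E_def scale_closed)
      show "(\<zero>, 0) \<in> E" using y by (auto simp: E_def zero_scale intro!: image_eqI[of _ _ 0])
      show "\<forall>u s u' s'. (u, s) \<in> E \<longrightarrow> (u', s') \<in> E \<longrightarrow> (u \<oplus> u', s + s') \<in> E"
        using y by (auto simp: E_def plus_scale[symmetric] distrib_right intro!: image_eqI)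
      show "\<forall>t u s. 0 \<le> t \<longrightarrow> (u, s) \<in> E \<longrightarrow> (t \<odot> u, t * s) \<in> E"
        using y by (auto simp: E_def scale_scale intro!: image_eqI)
    qed
    have "s \<le> q u" if "(u, s) \<in> E" for u s
      using that y by (auto simp: E_def sublinear_scale[OF q])
    then obtain p where p: "sublinear p" "\<forall>x\<in>carrier L. \<forall>(u, s)\<in>E. p x \<le> q (x \<oplus> u) - s"
      using sublinear_reduction[OF q E] by blast
    have "(\<zero>, 0) \<in> E" using E by (simp add: half_space_cone_def)
    then have "p x \<le> q x" if "x \<in> carrier L" for x
      using p(2) that by (force simp: plus_zero)
    then have "q x \<le> p x" using min[OF p(1)] x by blast
    moreover have "(y, q y) \<in> E"
      using y by (auto simp: E_def scale_one intro!: image_eqI[of _ _ 1])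
    ultimately have "q x \<le> q (x \<oplus> y) - q y" using p(2) x by force
    then show ?thesis using sublinear_add[OF q x y] by simp
  qed
  have neg: "q ((-1) \<odot> x) = - q x" if "x \<in> carrier L" for x
    using add[of x "(-1) \<odot> x"] that by (simp add: plus_uminus sublinear_zero[OF q] scale_closed)
  have "q (t \<odot> x) = t * q x" if x: "x \<in> carrier L" for t x
  proof (cases "0 \<le> t")
    case False
    have "q (t \<odot> x) = q ((-1) \<odot> ((- t) \<odot> x))" using x by (simp add: scale_scale)
    also have "\<dots> = t * q x"
      using x False by (simp only: neg scale_closed) (simp add: sublinear_scale[OF q])
    finally show ?thesis .
  qed (use x sublinear_scale[OF q] in auto)
  with add show ?thesis by (simp add: linear_functional_def)
qed

text \<open>Instead of extending functionals from subspaces, take a minimal element among all sublinear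
  functionals below \<open>p\<close>.\<close>

lemma Hahn_Banach_sublinear:
  assumes p: "sublinear p"
  shows "\<exists>\<xi>. linear_functional \<xi> \<and> (\<forall>x\<in>carrier L. \<xi> x \<le> p x)"
proof -
  \<comment> \<open>The value 0 off the carrier makes comparison on the carrier agree with the
    pointwise order on the whole type, to which Zorn's lemma is applied; \<open>clip\<close>
    enforces this value.\<close>
  define S where "S = {q. sublinear q \<and> (\<forall>x\<in>carrier L. q x \<le> p x) \<and> (\<forall>x. x \<notin> carrier L \<longrightarrow> q x = 0)}"
  define clip :: "('v \<Rightarrow> real) \<Rightarrow> 'v \<Rightarrow> real" where "clip q x = (if x \<in> carrier L then q x else 0)" for q x
  have clip: "clip q \<in> S" if "sublinear q" "\<And>x. x \<in> carrier L \<Longrightarrow> q x \<le> p x" for q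
    using that by (auto simp: S_def clip_def sublinear_def plus_closed scale_closed)
  \<comment> \<open>Zorn's lemma for the reversed order: chains need lower bounds, which are their
    pointwise infima, or \<open>p\<close> itself for the empty chain.\<close>
  have "\<exists>m\<in>S. \<forall>q\<in>S. m \<ge> q \<longrightarrow> q = m"
  proof (rule predicate_Zorn)
    show "partial_order_on S (relation_of (\<ge>) S)"
      by (rule partial_order_on_relation_ofI) auto
    fix Q assume Q: "Q \<in> Chains (relation_of (\<ge>) S)"
    then have QS: "Q \<subseteq> S" and ch: "\<And>q q'. q \<in> Q \<Longrightarrow> q' \<in> Q \<Longrightarrow> q \<le> q' \<or> q' \<le> q"
      by (auto simp: Chains_def relation_of_def)
    show "\<exists>u\<in>S. \<forall>q\<in>Q. q \<ge> u"
    proof (cases "Q = {}")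
      case True
      then show ?thesis using clip[OF p] by auto
    next
      case False
      let ?u = "\<lambda>x. INF q\<in>Q. q x"
      have chain: "(\<forall>x. q x \<le> q' x) \<or> (\<forall>x. q' x \<le> q x)" if "q \<in> Q" "q' \<in> Q" for q q'
        using ch[OF that] by (auto simp: le_fun_def)
      have sub: "sublinear q" if "q \<in> Q" for q using that QS by (auto simp: S_def)
      have le: "q x \<le> p x" if "q \<in> Q" "x \<in> carrier L" for q x using that QS by (auto simp: S_def)
      have u: "sublinear ?u" "\<And>q x. q \<in> Q \<Longrightarrow> x \<in> carrier L \<Longrightarrow> ?u x \<le> q x"
        using sublinear_chain_Inf[of Q p] False sub le chain by blast+
      obtain q0 where "q0 \<in> Q" using False by blast
      then have "?u x \<le> p x" if "x \<in> carrier L" for x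
        using u(2)[of q0 x] le[of q0 x] that by force
      then have "clip ?u \<in> S" using u(1) by (intro clip)
      moreover have "clip ?u \<le> q" if "q \<in> Q" for q
        using u(2)[OF that] that QS by (auto simp: le_fun_def clip_def S_def)
      ultimately show ?thesis by auto
    qed
  qed
  then obtain m where m: "m \<in> S" "\<And>q. q \<in> S \<Longrightarrow> q \<le> m \<Longrightarrow> q = m" by blast
  have "linear_functional m"
  proof (rule minimal_sublinear_linear)
    show "sublinear m" using m by (simp add: S_def)
    fix q x assume q: "sublinear q" "\<And>x. x \<in> carrier L \<Longrightarrow> q x \<le> m x" and x: "x \<in> carrier L"
    have "clip q \<in> S" using q m(1) by (intro clip) (auto simp: S_def intro: order_trans)
    moreover have "clip q \<le> m" using q m(1) by (auto simp: le_fun_def clip_def S_def)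
    ultimately have "clip q = m" by (rule m(2))
    then show "m x \<le> q x" using x by (auto simp: clip_def)
  qed
  with m(1) show ?thesis by (auto simp: S_def)
qed

text \<open>A linear \<xi> below the reduced functional \<open>p\<close> does both jobs: the
  constraint \<open>(\<zero>, 0)\<close> gives \<xi> \<le> \<open>q\<close>, and evaluating at
  \<open>(-1) \<odot> y\<close> against the constraint \<open>(y, s)\<close> gives - \<xi>
  \<open>y\<close> \<le> - \<open>s\<close>.\<close>

lemma Mazur_Orlicz:
  assumes q: "sublinear q" and E: "half_space_cone E" and le: "\<And>y s. (y, s) \<in> E \<Longrightarrow> s \<le> q y"
  shows "\<exists>\<xi>. linear_functional \<xi> \<and> (\<forall>x\<in>carrier L. \<xi> x \<le> q x) \<and> (\<forall>(y, s)\<in>E. s \<le> \<xi> y)"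
proof -
  obtain p where p: "sublinear p"
      "\<forall>x\<in>carrier L. \<forall>(y, s)\<in>E. p x \<le> q (x \<oplus> y) - s"
    using sublinear_reduction[OF q E le] by blast
  obtain \<xi> where \<xi>: "linear_functional \<xi>" "\<forall>x\<in>carrier L. \<xi> x \<le> p x"
    using Hahn_Banach_sublinear[OF p(1)] by blast
  show ?thesis
  proof (intro exI[of _ \<xi>] conjI ballI, goal_cases)
    case 1
    show ?case by (fact \<xi>(1))
  next
    case (2 x)
    then have x: "x \<in> carrier L" .
    have "(\<zero>, 0) \<in> E" using E by (simp add: half_space_cone_def)
    then have "p x \<le> q x" using p(2) x by (force simp: plus_zero)
    then show ?case using \<xi>(2) x by force
  next
    case (3 e)
    obtain y s where e: "e = (y, s)" by (cases e)
    with 3 have yE: "(y, s) \<in> E" by simp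
    then have y: "y \<in> carrier L" using E by (auto simp: half_space_cone_def)
    have "\<xi> ((-1) \<odot> y) \<le> q ((-1) \<odot> y \<oplus> y) - s"
      using bspec[OF \<xi>(2), of "(-1) \<odot> y"] bspec[OF bspec[OF p(2), of "(-1) \<odot> y"] yE] y
      by (simp add: scale_closed)
    also have "(-1) \<odot> y \<oplus> y = \<zero>" using y by (metis plus_commute plus_uminus scale_closed)
    finally show ?case using \<xi>(1) y e by (simp add: linear_functional_def sublinear_zero[OF q])
  qed
qed

end

section \<open>Separating a convex set from a cone at positive distance\<close>

context banach_lattice
begin

text \<open>Apply the Mazur-Orlicz theorem with the norm as sublinear functional and the constraints
  \<open>t * d\<close> \<le> \<xi> \<open>(t \<odot> x \<ominus> c)\<close>. They respect the norm
  because, for \<open>t > 0\<close>, \<open>N (t \<odot> x \<ominus> c)\<close> is \<open>t\<close>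
  times the distance of \<open>x\<close> from \<open>(1 / t) \<odot> c\<close>, again a point of
  \<open>C\<close>. The case \<open>t = 0\<close> yields \<xi> \<le> 0 on \<open>C\<close>; the case
  \<open>t = 1\<close>, \<open>c = \<zero>\<close> yields the bound on \<open>K\<close>.\<close>

lemma separation:
  assumes K: "K \<subseteq> carrier L" "K \<noteq> {}" "\<And>x y t. x \<in> K \<Longrightarrow> y \<in> K \<Longrightarrow> 0 \<le> t \<Longrightarrow> t \<le> 1 \<Longrightarrow> (1 - t) \<odot> x \<oplus> t \<odot> y \<in> K"
    and C: "C \<subseteq> carrier L" "C \<noteq> {}" "\<And>x y. x \<in> C \<Longrightarrow> y \<in> C \<Longrightarrow> x \<oplus> y \<in> C"
      "\<And>x t. x \<in> C \<Longrightarrow> 0 \<le> t \<Longrightarrow> t \<odot> x \<in> C"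
    and dist: "\<And>x c. x \<in> K \<Longrightarrow> c \<in> C \<Longrightarrow> d \<le> N (x \<ominus> c)"
  shows "\<exists>\<xi>. linear_functional \<xi> \<and> (\<forall>x\<in>carrier L. \<bar>\<xi> x\<bar> \<le> N x) \<and>
    (\<forall>c\<in>C. \<xi> c \<le> 0) \<and> (\<forall>x\<in>K. d \<le> \<xi> x)"
proof -
  define E where "E = {(t \<odot> x \<ominus> c, t * d) | t x c. 0 \<le> t \<and> x \<in> K \<and> c \<in> C}"
  have EI: "(y, s) \<in> E" if "0 \<le> t" "x \<in> K" "c \<in> C" "y = t \<odot> x \<ominus> c" "s = t * d" for y s t x c
    using that by (auto simp: E_def)
  have C0: "\<zero> \<in> C" using C(1,2) C(4)[of _ 0] by (metis all_not_in_conv order_refl subsetD zero_scale)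
  obtain k where k: "k \<in> K" using \<open>K \<noteq> {}\<close> by blast
  have q: "sublinear N" by (auto simp: sublinear_def norm_triangle norm_scale)
  have E: "half_space_cone E"
    unfolding half_space_cone_def
  proof (intro conjI)
    show "E \<subseteq> carrier L \<times> UNIV" using K C by (auto simp: E_def intro!: vminus_closed scale_closed)
    show "(\<zero>, 0) \<in> E"
      using k K C0 by (intro EI[of 0 k \<zero>]) (auto simp: zero_scale vminus_zero zero_closed subset_iff)
    show "\<forall>y s y' s'. (y, s) \<in> E \<longrightarrow> (y', s') \<in> E \<longrightarrow> (y \<oplus> y', s + s') \<in> E"
    proof clarify
      fix y s y' s' assume "(y, s) \<in> E" "(y', s') \<in> E"
      then obtain t x c t' x' c' where *: "y = t \<odot> x \<ominus> c" "s = t * d" "0 \<le> t" "x \<in> K" "c \<in> C"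
        "y' = t' \<odot> x' \<ominus> c'" "s' = t' * d" "0 \<le> t'" "x' \<in> K" "c' \<in> C"
        by (auto simp: E_def)
      then have cl: "x \<in> carrier L" "x' \<in> carrier L" "c \<in> carrier L" "c' \<in> carrier L"
        using K C by auto
      have sum: "y \<oplus> y' = (t \<odot> x \<oplus> t' \<odot> x') \<ominus> (c \<oplus> c')"
        using cl * by (simp add: plus_vminus_plus scale_closed)
      show "(y \<oplus> y', s + s') \<in> E"
      proof (cases "t + t' = 0")
        case True
        then have "t = 0" "t' = 0" using * by auto
        then show ?thesis
          using cl * sum k K C(3) by (intro EI[of 0 k "c \<oplus> c'"]) (auto simp: zero_scale zero_plus zero_closed subset_iff)
      next
        case False
        then have pos: "0 < t + t'" using * by auto
        \<comment> \<open>With this weight \<open>t \<odot> x \<oplus> t' \<odot> x'\<close> is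
          \<open>t + t'\<close> times a convex combination, which lies in \<open>K\<close>.\<close>
        define u where "u = t' / (t + t')"
        have u: "0 \<le> u" "u \<le> 1" "(t + t') * u = t'" "(t + t') * (1 - u) = t"
          using * pos by (auto simp: u_def field_simps)
        have "(t + t') \<odot> ((1 - u) \<odot> x \<oplus> u \<odot> x') = t \<odot> x \<oplus> t' \<odot> x'"
          using cl u by (simp add: scale_plus scale_closed scale_scale)
        then show ?thesis
          using K(3)[OF *(4,9) u(1,2)] C(3)[OF *(5,10)] pos sum *
          by (intro EI[of "t + t'" _ "c \<oplus> c'"]) (auto simp: distrib_right)
      qed
    qed
    show "\<forall>t y s. 0 \<le> t \<longrightarrow> (y, s) \<in> E \<longrightarrow> (t \<odot> y, t * s) \<in> E"
    proof clarify
      fix r y s assume r: "0 \<le> (r::real)" and "(y, s) \<in> E"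
      then obtain t x c where *: "y = t \<odot> x \<ominus> c" "s = t * d" "0 \<le> t" "x \<in> K" "c \<in> C"
        by (auto simp: E_def)
      then have "x \<in> carrier L" "c \<in> carrier L" using K C by auto
      then show "(r \<odot> y, r * s) \<in> E"
        using * r C(4) by (intro EI[of "r * t" x "r \<odot> c"]) (auto simp: scale_vminus scale_scale scale_closed)
    qed
  qed
  have "s \<le> N y" if yE: "(y, s) \<in> E" for y s
  proof -
    obtain t x c where *: "y = t \<odot> x \<ominus> c" "s = t * d" "0 \<le> t" "x \<in> K" "c \<in> C"
      using yE by (auto simp: E_def)
    then have cl: "x \<in> carrier L" "c \<in> carrier L" using K C by auto
    show ?thesis
    proof (cases "t = 0")
      case True
      then show ?thesis using * cl by (simp add: norm_nonneg vminus_closed scale_closed)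
    next
      case False
      then have t: "0 < t" using * by simp
      have "y = t \<odot> (x \<ominus> (1 / t) \<odot> c)"
        using * cl t by (simp add: scale_vminus scale_closed scale_scale scale_one)
      then have "N y = t * N (x \<ominus> (1 / t) \<odot> c)"
        using cl t by (simp add: norm_scale vminus_closed scale_closed)
      moreover have "d \<le> N (x \<ominus> (1 / t) \<odot> c)"
        using * t by (intro dist C(4)) auto
      ultimately show ?thesis using t * by simp
    qed
  qed
  then obtain \<xi> where \<xi>: "linear_functional \<xi>" "\<forall>x\<in>carrier L. \<xi> x \<le> N x"
    "\<forall>(y, s)\<in>E. s \<le> \<xi> y"
    using Mazur_Orlicz[OF q E] by blast
  have neg: "\<xi> ((-1) \<odot> x) = - \<xi> x" if "x \<in> carrier L" for x
    using \<xi>(1) that by (simp add: linear_functional_def)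
  show ?thesis
  proof (intro exI conjI ballI)
    show "\<bar>\<xi> x\<bar> \<le> N x" if x: "x \<in> carrier L" for x
      using bspec[OF \<xi>(2), of x] bspec[OF \<xi>(2), of "(-1) \<odot> x"] x
      by (simp add: neg scale_closed norm_scale)
    show "\<xi> c \<le> 0" if c: "c \<in> C" for c
    proof -
      have "((-1) \<odot> c, 0) \<in> E"
        using k K c C(1) by (intro EI[of 0 k c]) (auto simp: zero_scale vminus_def zero_plus scale_closed subset_iff)
      then show ?thesis using \<xi>(3) neg c C(1) by force
    qed
    show "d \<le> \<xi> x" if x: "x \<in> K" for x
    proof -
      have "(x, d) \<in> E"
        using x K C0 by (intro EI[of 1 x \<zero>]) (auto simp: scale_one vminus_zero subset_iff)
      then show ?thesis using \<xi>(3) by blast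
    qed
  qed (fact \<xi>(1))
qed

end

section \<open>The Halmos-Savage theorem\<close>

text \<open>The union of a maximising sequence lies in \<open>F\<close> and by monotonicity is at
  least as large as each term. The argument therefore applies to set functions that are only
  finitely additive.\<close>

lemma bounded_monotone_sup_attained:
  fixes \<mu> :: "'a set \<Rightarrow> real"
  assumes "F \<noteq> {}" and UN: "\<And>A :: nat \<Rightarrow> 'a set. range A \<subseteq> F \<Longrightarrow> (\<Union>n. A n) \<in> F"
    and mono: "\<And>A B. A \<in> F \<Longrightarrow> B \<in> F \<Longrightarrow> A \<subseteq> B \<Longrightarrow> \<mu> A \<le> \<mu> B"
    and bound: "\<And>A. A \<in> F \<Longrightarrow> \<mu> A \<le> b"
  shows "\<exists>E\<in>F. \<forall>A\<in>F. \<mu> A \<le> \<mu> E"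
proof -
  define s where "s = (SUP A\<in>F. \<mu> A)"
  have bdd: "bdd_above (\<mu> ` F)" using bound by (intro bdd_aboveI2)
  have "\<exists>A\<in>F. s - 1 / real (Suc n) < \<mu> A" for n
    using less_cSUP_iff[OF \<open>F \<noteq> {}\<close> bdd, of "s - 1 / real (Suc n)"] by (simp add: s_def)
  then obtain A where A: "\<And>n. A n \<in> F" "\<And>n. s - 1 / real (Suc n) < \<mu> (A n)" by metis
  define E where "E = (\<Union>n. A n)"
  have E: "E \<in> F" unfolding E_def using A(1) by (intro UN) auto
  have "s - \<mu> E \<le> inverse (real (Suc n))" for n
  proof -
    have "\<mu> (A n) \<le> \<mu> E" by (rule mono[OF A(1) E]) (auto simp: E_def)
    then show ?thesis using A(2)[of n] by (simp add: inverse_eq_divide)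
  qed
  then have "s \<le> \<mu> E"
    using LIMSEQ_le_const[OF LIMSEQ_inverse_real_of_nat, of "s - \<mu> E"] by auto
  moreover have "\<mu> A \<le> s" if "A \<in> F" for A unfolding s_def using that bdd by (intro cSUP_upper)
  ultimately show ?thesis using E by (meson order_trans)
qed

lemma upper_prob_eq_0_iff: "upper_prob P A = 0 \<longleftrightarrow> (\<forall>Q\<in>P. emeasure Q A = 0)"
  by (auto simp: upper_prob_def SUP_eq_iff bot_ennreal[symmetric] simp del: bot_ennreal)

lemma emeasure_subset_Un_eq_0:
  "\<lbrakk>A \<in> sets Q; B \<in> sets Q; emeasure Q A = 0; emeasure Q B = 0; C \<subseteq> A \<union> B\<rbrakk> \<Longrightarrow> emeasure Q C = 0"
  by (rule emeasure_eq_0[of "A \<union> B"]) (auto simp: emeasure_Un_null_set null_sets_def)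

text \<open>To each sequence \<open>p\<close> of priors belongs a set \<open>E p\<close> of largest
  \<mu> among the common null sets \<open>Z p\<close>. For a \<open>p\<close> that makes \<mu>
  \<open>(E p)\<close> minimal, adding a further prior gains nothing, so \<open>E p\<close> is null
  for all of \<open>P\<close>. Any other common null set \<open>A\<close> has \<mu>
  \<open>(A - E p) = 0\<close> by maximality of \<open>E p\<close>, so it is null for all of
  \<open>P\<close> as well.\<close>

lemma Halmos_Savage_countable:
  fixes M :: "'a measure" and P :: "'a measure set" and \<mu> :: "'a set \<Rightarrow> real"
  assumes "P \<noteq> {}" and P: "\<And>Q. Q \<in> P \<Longrightarrow> sets Q = sets M"
    and nonneg: "\<And>A. A \<in> sets M \<Longrightarrow> 0 \<le> \<mu> A"
    and add: "\<And>A B. A \<in> sets M \<Longrightarrow> B \<in> sets M \<Longrightarrow> A \<inter> B = {} \<Longrightarrow> \<mu> (A \<union> B) = \<mu> A + \<mu> B"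
    and null: "\<And>A. A \<in> sets M \<Longrightarrow> \<mu> A = 0 \<Longrightarrow> upper_prob P A = 0"
  shows "\<exists>p. range (p :: nat \<Rightarrow> 'a measure) \<subseteq> P \<and>
    (\<forall>A\<in>sets M. (\<forall>n. emeasure (p n) A = 0) \<longrightarrow> upper_prob P A = 0)"
proof -
  have mono: "\<mu> A \<le> \<mu> B" if "A \<in> sets M" "B \<in> sets M" "A \<subseteq> B" for A B
    using add[of A "B - A"] nonneg[of "B - A"] that by (simp add: sets.Diff Un_absorb1)
  define Z where "Z p = {A \<in> sets M. \<forall>n. emeasure (p n) A = 0}" for p :: "nat \<Rightarrow> 'a measure"
  have "\<exists>E\<in>Z p. \<forall>A\<in>Z p. \<mu> A \<le> \<mu> E" if p: "range p \<subseteq> P" for p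
  proof (rule bounded_monotone_sup_attained)
    show "Z p \<noteq> {}" by (auto simp: Z_def)
    show "(\<Union>n. A n) \<in> Z p" if "range A \<subseteq> Z p" for A :: "nat \<Rightarrow> 'a set"
    proof -
      have "A n \<in> sets M" "emeasure (p m) (A n) = 0" for m n
        using that by (auto simp: Z_def)
      moreover have "sets (p m) = sets M" for m using p P by auto
      ultimately show ?thesis by (auto simp: Z_def intro!: emeasure_UN_eq_0)
    qed
    show "\<mu> A \<le> \<mu> B" if "A \<in> Z p" "B \<in> Z p" "A \<subseteq> B" for A B
      using that mono by (auto simp: Z_def)
    show "\<mu> A \<le> \<mu> (space M)" if "A \<in> Z p" for A
      using that by (auto simp: Z_def intro!: mono dest: sets.sets_into_space)
  qed
  then obtain E where E: "\<And>p. range p \<subseteq> P \<Longrightarrow> E p \<in> Z p"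
    "\<And>p A. range p \<subseteq> P \<Longrightarrow> A \<in> Z p \<Longrightarrow> \<mu> A \<le> \<mu> (E p)"
    by metis
  have EM: "E p \<in> sets M" if "range p \<subseteq> P" for p using E(1)[OF that] by (simp add: Z_def)
  define S where "S = {p :: nat \<Rightarrow> 'a measure. range p \<subseteq> P}"
  obtain Q0 where "Q0 \<in> P" using \<open>P \<noteq> {}\<close> by blast
  then have "(\<lambda>_. Q0) \<in> S" by (auto simp: S_def)
  then have "S \<noteq> {}" by blast
  define i where "i = (INF p\<in>S. \<mu> (E p))"
  have bdd: "bdd_below ((\<lambda>p. \<mu> (E p)) ` S)"
    using nonneg EM by (intro bdd_belowI2[of _ 0]) (auto simp: S_def)
  have "\<exists>p\<in>S. \<mu> (E p) < i + 1 / real (Suc n)" for n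
    using cINF_less_iff[OF \<open>S \<noteq> {}\<close> bdd, of "i + 1 / real (Suc n)"] by (simp add: i_def)
  then obtain q where q: "\<And>n. q n \<in> S" "\<And>n. \<mu> (E (q n)) < i + 1 / real (Suc n)" by metis
  \<comment> \<open>The minimising sequences \<open>q m\<close> are merged into one. It has fewer
    common null sets than each of them, hence it attains the infimum \<open>i\<close>.\<close>
  define p where "p k = (case prod_decode k of (m, n) \<Rightarrow> q m n)" for k
  have p: "range p \<subseteq> P" using q(1) by (fastforce simp: p_def S_def split: prod.split)
  have pq: "q m n = p (prod_encode (m, n))" for m n by (simp add: p_def)
  have "Z p \<subseteq> Z (q m)" for m by (auto simp: Z_def pq)
  then have "\<mu> (E p) \<le> \<mu> (E (q m))" for m
    using E(1)[OF p] E(2)[of "q m" "E p"] q(1)[of m] by (auto simp: S_def)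
  then have "\<mu> (E p) - i \<le> inverse (real (Suc m))" for m
    using q(2)[of m] by (smt (verit) inverse_eq_divide)
  then have min: "\<mu> (E p) \<le> i"
    using LIMSEQ_le_const[OF LIMSEQ_inverse_real_of_nat, of "\<mu> (E p) - i"] by auto
  have null_E: "upper_prob P (E p) = 0"
    unfolding upper_prob_eq_0_iff
  proof
    fix Q assume Q: "Q \<in> P"
    \<comment> \<open>Put \<open>Q\<close> in front of \<open>p\<close>. The sets \<open>E p\<close>
      and \<open>E p'\<close> need not be nested, so they are compared through their union, which is
      still in \<open>Z p\<close>: its \<mu> is at most \<mu> \<open>(E p)\<close>, which by
      minimality is at most \<mu> \<open>(E p')\<close>. The difference \<open>?D\<close> thus has
      \<mu> equal to 0.\<close>
    define p' where "p' = case_nat Q p"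
    have p': "range p' \<subseteq> P" using p Q by (auto simp: p'_def subset_iff split: nat.splits)
    have Zp': "Z p' = {A \<in> Z p. emeasure Q A = 0}"
      by (auto simp: Z_def p'_def split: nat.splits)
    have E': "E p' \<in> Z p" "emeasure Q (E p') = 0" using E(1)[OF p'] Zp' by auto
    let ?D = "E p - E p'"
    have "\<mu> (E p) \<le> \<mu> (E p')"
      using cINF_lower[OF bdd, of p'] min p' by (simp add: i_def S_def)
    moreover have "E p \<union> E p' \<in> Z p"
    proof -
      have "sets (p n) = sets M" for n using p P by auto
      then show ?thesis
        using E(1)[OF p] E'(1) by (auto simp: Z_def intro: emeasure_subset_Un_eq_0[of "E p" _ "E p'"])
    qed
    then have "\<mu> (E p' \<union> ?D) \<le> \<mu> (E p)" using E(2)[OF p] by (simp add: Un_commute)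
    then have "\<mu> (E p') + \<mu> ?D \<le> \<mu> (E p)"
      using add[of "E p'" ?D] EM[OF p] EM[OF p'] by auto
    ultimately have "\<mu> ?D = 0" using nonneg[of ?D] EM[OF p] EM[OF p'] by auto
    then have D: "emeasure Q ?D = 0"
      using null[of ?D] EM[OF p] EM[OF p'] Q by (auto simp: upper_prob_eq_0_iff)
    show "emeasure Q (E p) = 0"
      by (rule emeasure_subset_Un_eq_0[OF _ _ E'(2) D]) (use EM[OF p] EM[OF p'] P[OF Q] in auto)
  qed
  have "upper_prob P A = 0" if A: "A \<in> sets M" "\<And>n. emeasure (p n) A = 0" for A
  proof -
    have "A \<union> E p \<in> Z p"
    proof -
      have "sets (p n) = sets M" for n using p P by auto
      then show ?thesis
        using E(1)[OF p] A by (auto simp: Z_def intro: emeasure_subset_Un_eq_0[of A _ "E p"])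
    qed
    then have "\<mu> (E p \<union> (A - E p)) \<le> \<mu> (E p)" using E(2)[OF p] by (simp add: Un_commute)
    then have "\<mu> (A - E p) = 0"
      using add[of "E p" "A - E p"] EM[OF p] nonneg[of "A - E p"] A by auto
    then have D: "upper_prob P (A - E p) = 0" using A EM[OF p] by (intro null) auto
    show ?thesis
      unfolding upper_prob_eq_0_iff
    proof
      fix Q assume Q: "Q \<in> P"
      have "emeasure Q (E p) = 0" "emeasure Q (A - E p) = 0"
        using D null_E Q by (auto simp: upper_prob_eq_0_iff)
      then show "emeasure Q A = 0"
        by (rule emeasure_subset_Un_eq_0[rotated 2]) (use EM[OF p] A(1) P[OF Q] in auto)
    qed
  qed
  then show ?thesis using p by blast
qed

text \<open>A mixture of the countably many priors with positive weights has exactly their common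
  null sets.\<close>

lemma Halmos_Savage:
  fixes M :: "'a measure" and P :: "'a measure set" and \<mu> :: "'a set \<Rightarrow> real"
  assumes "P \<noteq> {}" and P: "P \<subseteq> space (prob_algebra M)"
    and "\<And>A. A \<in> sets M \<Longrightarrow> 0 \<le> \<mu> A"
    and "\<And>A B. A \<in> sets M \<Longrightarrow> B \<in> sets M \<Longrightarrow> A \<inter> B = {} \<Longrightarrow> \<mu> (A \<union> B) = \<mu> A + \<mu> B"
    and "\<And>A. A \<in> sets M \<Longrightarrow> \<mu> A = 0 \<Longrightarrow> upper_prob P A = 0"
  shows "\<exists>Q\<in>space (prob_algebra M). \<forall>A\<in>sets M. emeasure Q A = 0 \<longleftrightarrow> upper_prob P A = 0"
proof -
  have "sets Q = sets M" if "Q \<in> P" for Q using that P by (auto simp: space_prob_algebra)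
  then obtain p :: "nat \<Rightarrow> 'a measure" where p: "range p \<subseteq> P"
    "\<forall>A\<in>sets M. (\<forall>n. emeasure (p n) A = 0) \<longrightarrow> upper_prob P A = 0"
    using Halmos_Savage_countable[of P M \<mu>] assms by blast
  \<comment> \<open>The geometric distribution gives every natural number positive mass, so the
    integral over \<open>G\<close> of \<open>emeasure (p n) A\<close> vanishes only if every term
    does.\<close>
  define G where "G = measure_pmf (geometric_pmf (1/2))"
  have G: "G \<in> space (prob_algebra (count_space UNIV))"
    by (simp add: G_def space_prob_algebra prob_space_measure_pmf)
  have p_meas: "p \<in> count_space UNIV \<rightarrow>\<^sub>M prob_algebra M" using p P by auto
  define Q where "Q = G \<bind> p"
  have Q: "Q \<in> space (prob_algebra M)"
    unfolding Q_def
    using measurable_space[OF measurable_bind_prob_space[of "\<lambda>_ :: nat. G" "count_space UNIV", OF _ p_meas], of 0] G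
    by simp
  have "emeasure Q A = 0 \<longleftrightarrow> (\<forall>n. emeasure (p n) A = 0)" if A: "A \<in> sets M" for A
  proof -
    have "emeasure Q A = (\<integral>\<^sup>+ n. emeasure (p n) A \<partial>G)"
      unfolding Q_def using A p_meas
      by (intro emeasure_bind_prob_algebra[OF G]) auto
    then show ?thesis
      by (simp add: G_def nn_integral_0_iff_AE AE_measure_pmf_iff set_pmf_geometric)
  qed
  then show ?thesis
    using p Q by (intro bexI[of _ Q]) (auto simp: upper_prob_eq_0_iff subset_iff)
qed

section \<open>Almost uniform limits in decreasing convex sets\<close>

text \<open>The infima of the squared \<open>L2\<close> norm \<open>J\<close> over the decreasing
  sets \<open>S k\<close> increase to a finite \<open>a\<close>. For near-minimisers the midpoint
  cannot have \<open>J\<close> much below \<open>a\<close>, so the parallelogram law makes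
  successive differences small in \<open>L2\<close>. Markov's inequality makes them uniformly small
  off sets of summable measure, and the Weierstrass test gives the limit.\<close>

lemma midpoint_convex_uniform_limit:
  fixes S :: "nat \<Rightarrow> ('a \<Rightarrow> real) set"
  assumes "prob_space Q" and "0 < \<eta>"
    and nonempty: "\<And>k. S k \<noteq> {}" and decr: "\<And>k. S (Suc k) \<subseteq> S k"
    and meas: "\<And>k f. f \<in> S k \<Longrightarrow> f \<in> borel_measurable Q"
    and bounded: "\<And>k f x. f \<in> S k \<Longrightarrow> 0 \<le> f x \<and> f x \<le> 1"
    and midpoint: "\<And>k f g. f \<in> S k \<Longrightarrow> g \<in> S k \<Longrightarrow> (\<lambda>x. (f x + g x) / 2) \<in> S k"
  shows "\<exists>g f B. (\<forall>i. g i \<in> S i) \<and> f \<in> borel_measurable Q \<and> B \<in> sets Q \<and>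
    measure Q (space Q - B) \<le> \<eta> \<and> uniform_limit B g f sequentially"
proof -
  interpret prob_space Q by fact
  define J where "J f = (\<integral>x. (f x)\<^sup>2 \<partial>Q)" for f :: "'a \<Rightarrow> real"
  have anti: "S k \<subseteq> S i" if "i \<le> k" for i k using lift_Suc_antimono_le[of S, OF decr that] .
  have int: "integrable Q (\<lambda>x. (f x)\<^sup>2)" if "f \<in> S k" for f k
    using that meas bounded by (intro integrable_const_bound[where B=1]) (auto simp: power_le_one)
  have J01: "0 \<le> J f" "J f \<le> 1" if f: "f \<in> S k" for f k
  proof -
    show "0 \<le> J f" by (simp add: J_def)
    have "J f \<le> (\<integral>x. 1 \<partial>Q)"
      unfolding J_def using f bounded by (intro integral_mono int) (auto simp: power_le_one)
    then show "J f \<le> 1" by (simp add: prob_space)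
  qed
  define I where "I k = (INF f\<in>S k. J f)" for k
  have bdd: "bdd_below (J ` S k)" for k using J01 by (intro bdd_belowI2[of _ 0])
  have I_le: "I k \<le> J f" if "f \<in> S k" for f k
    unfolding I_def using that bdd by (intro cINF_lower)
  have I1: "I k \<le> 1" for k
    using nonempty[of k] I_le J01 by (metis all_not_in_conv order_trans)
  define a where "a = (SUP k. I k)"
  have bdd_I: "bdd_above (range I)" using I1 by (intro bdd_aboveI2)
  have I_a: "I k \<le> a" for k
    unfolding a_def using bdd_I by (intro cSUP_upper) auto
  \<comment> \<open>Markov's inequality will divide \<open>8 *\<close> \<theta> \<open>i\<close> by
    \<open>(1/4) ^ i\<close>. The ratio \<open>1/8\<close> and the factor \<eta> \<open>/ 16\<close>
    turn the quotient into \<eta> \<open>* (1/2) ^ Suc i\<close>, and these add up to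
    \<eta>.\<close>
  define \<theta> where "\<theta> i = \<eta> / 16 * (1/8) ^ i" for i :: nat
  have \<theta>: "0 < \<theta> i" "\<theta> (Suc i) \<le> \<theta> i" for i using \<open>0 < \<eta>\<close> by (auto simp: \<theta>_def)
  \<comment> \<open>The index must be large enough for the infimum to be near \<open>a\<close>, and
    at least \<open>i\<close> so that the chosen function lies in \<open>S i\<close>.\<close>
  have "\<exists>k\<ge>i. \<exists>f\<in>S k. a - \<theta> i \<le> I k \<and> J f \<le> a + \<theta> i" for i
  proof -
    have "\<exists>k. a - \<theta> i < I k"
      using less_cSUP_iff[OF _ bdd_I, of "a - \<theta> i"] \<theta>(1)[of i] by (simp add: a_def)
    then obtain k0 where k0: "a - \<theta> i < I k0" by blast
    define k where "k = max i k0"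
    have "I k0 \<le> I k"
      unfolding I_def using nonempty anti[of k0 k] bdd by (intro cINF_superset_mono) (auto simp: k_def)
    moreover obtain f where "f \<in> S k" "J f < I k + \<theta> i"
      using cINF_less_iff[OF nonempty bdd, of k "I k + \<theta> i"] \<theta>(1)[of i] by (auto simp: I_def)
    ultimately show ?thesis using k0 I_a[of k] by (intro exI[of _ k]) (auto simp: k_def intro!: bexI[of _ f])
  qed
  then obtain k g where k: "\<And>i. i \<le> k i" and g: "\<And>i. g i \<in> S (k i)"
    and Ik: "\<And>i. a - \<theta> i \<le> I (k i)" and Jg: "\<And>i. J (g i) \<le> a + \<theta> i"
    by metis
  have g_meas [measurable]: "g i \<in> borel_measurable Q" for i using g meas by blast
  define D where "D i x = g (Suc i) x - g i x" for i x
  have D_meas [measurable]: "D i \<in> borel_measurable Q" for i unfolding D_def by measurable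
  have D2_int: "integrable Q (\<lambda>x. (D i x)\<^sup>2)" for i
  proof (rule integrable_const_bound[where B=1])
    have "\<bar>D i x\<bar> \<le> 1" for x using bounded[OF g, of i x] bounded[OF g, of "Suc i" x] by (auto simp: D_def)
    then show "AE x in Q. norm ((D i x)\<^sup>2) \<le> 1" by (simp add: abs_square_le_1)
  qed simp
  have J_D: "J (D i) \<le> 8 * \<theta> i" for i
  proof -
    \<comment> \<open>The indices \<open>k i\<close> are not chosen monotonically in
      \<open>i\<close>; the smaller of two successive ones gives a set containing both functions and
      hence their midpoint \<open>h\<close>.\<close>
    define m where "m = min (k i) (k (Suc i))"
    define h where "h x = (g i x + g (Suc i) x) / 2" for x
    have "g i \<in> S m" "g (Suc i) \<in> S m"
      using g anti[of m "k i"] anti[of m "k (Suc i)"] by (auto simp: m_def)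
    then have h: "h \<in> S m" unfolding h_def by (rule midpoint)
    have "a - \<theta> i \<le> I m" using Ik[of i] Ik[of "Suc i"] \<theta>(2)[of i] by (auto simp: m_def min_def)
    then have "a - \<theta> i \<le> J h" using I_le[OF h] by simp
    moreover have "J (D i) = 2 * J (g i) + 2 * J (g (Suc i)) - 4 * J h"
    proof -
      have "(D i x)\<^sup>2 = 2 * (g i x)\<^sup>2 + 2 * (g (Suc i) x)\<^sup>2 - 4 * (h x)\<^sup>2" for x
        by (simp add: D_def h_def power2_eq_square field_simps)
      then show ?thesis
        using int[OF g, of i] int[OF g, of "Suc i"] int[OF h] by (simp add: J_def)
    qed
    ultimately show ?thesis using Jg[of i] Jg[of "Suc i"] \<theta>(2)[of i] by simp
  qed
  \<comment> \<open>Here the difference is at least \<open>(1/2) ^ i\<close> in absolute value,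
    written with squares to match \<open>J\<close>.\<close>
  define A where "A i = {x \<in> space Q. (1/4) ^ i \<le> (D i x)\<^sup>2}" for i :: nat
  have A_sets [measurable]: "A i \<in> sets Q" for i unfolding A_def by measurable
  have A_le: "prob (A i) \<le> \<eta> * (1/2) ^ Suc i" for i
  proof -
    have "prob (A i) \<le> J (D i) / (1/4) ^ i"
      unfolding A_def J_def by (rule integral_Markov_inequality_measure[where A="{}"]) (use D2_int in auto)
    also have "\<dots> \<le> 8 * \<theta> i / (1/4) ^ i" using J_D by (intro divide_right_mono) auto
    also have "\<dots> = \<eta> * (1/2) ^ Suc i"
      by (simp add: \<theta>_def power_divide field_simps flip: power_mult_distrib)
    finally show ?thesis .
  qed
  define B where "B = space Q - (\<Union>i. A i)"
  have "prob (\<Union>i. A i) \<le> (\<Sum>i. \<eta> * (1/2) ^ Suc i)"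
  proof -
    have sm: "summable (\<lambda>i. \<eta> * (1/2) ^ Suc i)" by (intro summable_mult sums_summable[OF power_half_series])
    have sA: "summable (\<lambda>i. prob (A i))"
      by (rule summable_comparison_test'[OF sm]) (use A_le in simp)
    have "prob (\<Union>i. A i) \<le> (\<Sum>i. prob (A i))"
      by (rule finite_measure_subadditive_countably) (use sA in auto)
    also have "\<dots> \<le> (\<Sum>i. \<eta> * (1/2) ^ Suc i)" using A_le sA sm by (intro suminf_le)
    finally show ?thesis .
  qed
  also have "\<dots> = \<eta>" using sums_mult[OF power_half_series, of \<eta>] by (simp add: sums_iff)
  finally have "prob (space Q - B) \<le> \<eta>"
    by (simp add: B_def Diff_Diff_Int Int_absorb1 sets.sets_into_space UN_subset_iff)
  moreover have "B \<in> sets Q" unfolding B_def by measurable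
  moreover have "g i \<in> S i" for i using g k anti by blast
  \<comment> \<open>On \<open>B\<close> the sum telescopes to the limit of \<open>g\<close>. Off
    \<open>B\<close> it may diverge; \<open>suminf\<close> still yields a measurable function there,
    and no claim is made about its values.\<close>
  moreover define f where "f x = g 0 x + (\<Sum>i. D i x)" for x
  moreover have "f \<in> borel_measurable Q" unfolding f_def by measurable
  moreover have "uniform_limit B g f sequentially"
  proof -
    have "norm (D i x) \<le> (1/2) ^ i" if "x \<in> B" for i x
    proof -
      have "(D i x)\<^sup>2 \<le> (1/4) ^ i"
        using that by (auto simp: B_def A_def not_le intro: less_imp_le)
      also have "\<dots> = ((1/2) ^ i)\<^sup>2" by (simp add: power2_eq_square flip: power_mult_distrib)
      finally have "(D i x)\<^sup>2 \<le> ((1/2) ^ i)\<^sup>2" .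
      then show ?thesis by (simp add: power2_le_iff_abs_le)
    qed
    then have "uniform_limit B (\<lambda>n x. \<Sum>i<n. D i x) (\<lambda>x. \<Sum>i. D i x) sequentially"
      by (intro Weierstrass_m_test[where M="\<lambda>i. (1/2) ^ i"] summable_geometric) auto
    then have "uniform_limit B (\<lambda>n x. g 0 x + (\<Sum>i<n. D i x)) f sequentially"
      unfolding f_def by (intro uniform_limit_add uniform_limit_const)
    moreover have "g 0 x + (\<Sum>i<n. D i x) = g n x" for n x
      using sum_lessThan_telescope[of "\<lambda>i. g i x" n] by (simp add: D_def)
    ultimately show ?thesis by (simp add: fun_eq_iff)
  qed
  ultimately show ?thesis by blast
qed

section \<open>Quasi-sure equivalence classes\<close>

lemma Ball_subset_image: "U \<subseteq> f ` V \<Longrightarrow> (\<forall>x\<in>U. R x) \<longleftrightarrow> (\<forall>h\<in>V. f h \<in> U \<longrightarrow> R (f h))"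
  by blast

locale quasi_sure =
  fixes M :: "'a measure" and P :: "'a measure set"
  assumes P_prob: "P \<subseteq> space (prob_algebra M)"
begin

abbreviation cls :: "('a \<Rightarrow> real) \<Rightarrow> ('a \<Rightarrow> real) set" where "cls \<equiv> qs_class M P"

abbreviation qs :: "('a \<Rightarrow> bool) \<Rightarrow> bool" where "qs \<equiv> quasi_surely M P"

lemma sets_P: "Q \<in> P \<Longrightarrow> sets Q = sets M"
  using P_prob by (auto simp: space_prob_algebra)

lemma upper_prob_Un:
  assumes "A \<in> sets M" "B \<in> sets M" "upper_prob P A = 0" "upper_prob P B = 0"
  shows "upper_prob P (A \<union> B) = 0"
  using assms sets_P by (auto simp: upper_prob_eq_0_iff emeasure_Un_null_set null_sets_def)

lemma upper_prob_mono:
  assumes "A \<subseteq> B" "B \<in> sets M" "upper_prob P B = 0"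
  shows "upper_prob P A = 0"
  using assms emeasure_mono[of A B] sets_P by (fastforce simp: upper_prob_eq_0_iff)

lemma quasi_surelyI: "(\<And>\<omega>. \<omega> \<in> space M \<Longrightarrow> R \<omega>) \<Longrightarrow> qs R"
  unfolding quasi_surely_def by (intro bexI[of _ "{}"]) (auto simp: upper_prob_eq_0_iff)

lemma quasi_surely_mono:
  "\<lbrakk>qs R; \<And>\<omega>. \<omega> \<in> space M \<Longrightarrow> R \<omega> \<Longrightarrow> R' \<omega>\<rbrakk> \<Longrightarrow> qs R'"
  by (auto simp: quasi_surely_def)

lemma quasi_surely_conj:
  assumes "qs R" "qs R'"
  shows "qs (\<lambda>\<omega>. R \<omega> \<and> R' \<omega>)"
proof -
  obtain A B where "A \<in> sets M" "upper_prob P A = 0" "\<forall>\<omega>\<in>space M - A. R \<omega>"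
      "B \<in> sets M" "upper_prob P B = 0" "\<forall>\<omega>\<in>space M - B. R' \<omega>"
    using assms by (auto simp: quasi_surely_def)
  then show ?thesis
    unfolding quasi_surely_def by (intro bexI[of _ "A \<union> B"]) (auto simp: upper_prob_Un)
qed

lemma quasi_surely_mono2:
  "\<lbrakk>qs R; qs R'; \<And>\<omega>. \<omega> \<in> space M \<Longrightarrow> R \<omega> \<Longrightarrow> R' \<omega> \<Longrightarrow> R'' \<omega>\<rbrakk> \<Longrightarrow> qs R''"
  using quasi_surely_mono[OF quasi_surely_conj[of R R'], of R''] by blast

lemma mem_qs_class:
  "f \<in> borel_measurable M \<Longrightarrow> g \<in> cls f \<longleftrightarrow> g \<in> borel_measurable M \<and> qs (\<lambda>\<omega>. f \<omega> = g \<omega>)"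
  by (auto simp: qs_class_def qs_eq_def)

lemma equiv_qs_eq: "equiv (borel_measurable M) (qs_eq M P)"
proof (rule equivI)
  show "qs_eq M P \<subseteq> borel_measurable M \<times> borel_measurable M" by (auto simp: qs_eq_def)
  show "refl_on (borel_measurable M) (qs_eq M P)" by (auto simp: refl_on_def qs_eq_def intro: quasi_surelyI)
  show "sym (qs_eq M P)"
    unfolding sym_def qs_eq_def using quasi_surely_mono by fastforce
  show "trans (qs_eq M P)"
  proof (rule transI)
    fix f g h assume "(f, g) \<in> qs_eq M P" "(g, h) \<in> qs_eq M P"
    then show "(f, h) \<in> qs_eq M P"
      using quasi_surely_mono2[of "\<lambda>\<omega>. f \<omega> = g \<omega>" "\<lambda>\<omega>. g \<omega> = h \<omega>" "\<lambda>\<omega>. f \<omega> = h \<omega>"]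
      by (simp add: qs_eq_def)
  qed
qed

lemma self_mem_qs_class: "f \<in> borel_measurable M \<Longrightarrow> f \<in> cls f"
  by (simp add: mem_qs_class quasi_surelyI)

lemma qs_class_eq_iff:
  "\<lbrakk>f \<in> borel_measurable M; g \<in> borel_measurable M\<rbrakk> \<Longrightarrow> cls f = cls g \<longleftrightarrow> qs (\<lambda>\<omega>. f \<omega> = g \<omega>)"
  using eq_equiv_class_iff[OF equiv_qs_eq, of f g] by (auto simp: qs_class_def qs_eq_def)

section \<open>Operations, order and absolute value through representatives\<close>

lemma carrier_L0: "carrier (L0 M P) = cls ` borel_measurable M"
  by (auto simp: L0_def quotient_def qs_class_def)

text \<open>All pairs of representatives give the same class, so the union in the definition of the
  sum is a union of equal sets over a nonempty index set.\<close>

lemma vplus_L0: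
  assumes "f \<in> borel_measurable M" "g \<in> borel_measurable M"
  shows "vplus (L0 M P) (cls f) (cls g) = cls (\<lambda>\<omega>. f \<omega> + g \<omega>)"
proof -
  have "cls (\<lambda>\<omega>. f' \<omega> + g' \<omega>) = cls (\<lambda>\<omega>. f \<omega> + g \<omega>)" if "f' \<in> cls f" "g' \<in> cls g" for f' g'
    using that assms quasi_surely_mono2[of "\<lambda>\<omega>. f \<omega> = f' \<omega>" "\<lambda>\<omega>. g \<omega> = g' \<omega>" "\<lambda>\<omega>. f' \<omega> + g' \<omega> = f \<omega> + g \<omega>"]
    by (subst qs_class_eq_iff) (auto simp: mem_qs_class)
  then have "vplus (L0 M P) (cls f) (cls g) = (\<Union>f'\<in>cls f. \<Union>g'\<in>cls g. cls (\<lambda>\<omega>. f \<omega> + g \<omega>))"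
    by (simp add: L0_def cong: SUP_cong)
  moreover have "cls f \<noteq> {}" "cls g \<noteq> {}" using assms self_mem_qs_class by blast+
  ultimately show ?thesis by simp
qed

lemma vscale_L0:
  assumes "f \<in> borel_measurable M"
  shows "vscale (L0 M P) t (cls f) = cls (\<lambda>\<omega>. t * f \<omega>)"
proof -
  have "cls (\<lambda>\<omega>. t * f' \<omega>) = cls (\<lambda>\<omega>. t * f \<omega>)" if "f' \<in> cls f" for f'
    using that assms quasi_surely_mono[of "\<lambda>\<omega>. f \<omega> = f' \<omega>" "\<lambda>\<omega>. t * f' \<omega> = t * f \<omega>"]
    by (subst qs_class_eq_iff) (auto simp: mem_qs_class)
  then have "vscale (L0 M P) t (cls f) = (\<Union>f'\<in>cls f. cls (\<lambda>\<omega>. t * f \<omega>))"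
    by (simp add: L0_def cong: SUP_cong)
  moreover have "cls f \<noteq> {}" using assms self_mem_qs_class by blast
  ultimately show ?thesis by simp
qed

lemma vzero_L0: "vzero (L0 M P) = cls (\<lambda>_. 0)"
  by (simp add: L0_def)

lemma le_L0:
  assumes "f \<in> borel_measurable M" "g \<in> borel_measurable M"
  shows "le (L0 M P) (cls f) (cls g) \<longleftrightarrow> qs (\<lambda>\<omega>. f \<omega> \<le> g \<omega>)"
proof
  assume "le (L0 M P) (cls f) (cls g)"
  then obtain f' g' where *: "f' \<in> cls f" "g' \<in> cls g" "qs (\<lambda>\<omega>. f' \<omega> \<le> g' \<omega>)"
    by (auto simp: L0_def)
  then have "qs (\<lambda>\<omega>. f \<omega> = f' \<omega> \<and> g \<omega> = g' \<omega>)"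
    using assms by (intro quasi_surely_conj) (auto simp: mem_qs_class)
  from quasi_surely_mono2[OF *(3) this] show "qs (\<lambda>\<omega>. f \<omega> \<le> g \<omega>)" by auto
qed (use assms[THEN self_mem_qs_class] in \<open>auto simp: L0_def\<close>)

text \<open>The join is a chosen least upper bound relative to the carrier, so its value could
  depend on the carrier. Once the class of the pointwise absolute value lies in \<open>Y\<close>, it
  is the only least upper bound there, and the choice is forced. A general \<open>Y\<close> covers
  both the full space and the ideal.\<close>

lemma vabs_L0:
  assumes Y: "Y \<subseteq> carrier (L0 M P)" and f: "f \<in> borel_measurable M"
    and mem: "cls f \<in> Y" "cls (\<lambda>\<omega>. - f \<omega>) \<in> Y" "cls (\<lambda>\<omega>. \<bar>f \<omega>\<bar>) \<in> Y"
  shows "vabs (L0 M P\<lparr>carrier := Y\<rparr>) (cls f) = cls (\<lambda>\<omega>. \<bar>f \<omega>\<bar>)"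
proof -
  let ?L = "L0 M P\<lparr>carrier := Y\<rparr>" and ?A = "{cls f, cls (\<lambda>\<omega>. - f \<omega>)}"
  have Upper: "cls g \<in> Upper ?L ?A \<longleftrightarrow> cls g \<in> Y \<and> qs (\<lambda>\<omega>. \<bar>f \<omega>\<bar> \<le> g \<omega>)"
    if [measurable]: "g \<in> borel_measurable M" for g
  proof -
    have "qs (\<lambda>\<omega>. \<bar>f \<omega>\<bar> \<le> g \<omega>) \<longleftrightarrow> qs (\<lambda>\<omega>. f \<omega> \<le> g \<omega>) \<and> qs (\<lambda>\<omega>. - f \<omega> \<le> g \<omega>)"
    proof
      assume "qs (\<lambda>\<omega>. \<bar>f \<omega>\<bar> \<le> g \<omega>)"
      then show "qs (\<lambda>\<omega>. f \<omega> \<le> g \<omega>) \<and> qs (\<lambda>\<omega>. - f \<omega> \<le> g \<omega>)"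
        by (intro conjI; rule quasi_surely_mono; simp)
    next
      assume "qs (\<lambda>\<omega>. f \<omega> \<le> g \<omega>) \<and> qs (\<lambda>\<omega>. - f \<omega> \<le> g \<omega>)"
      then show "qs (\<lambda>\<omega>. \<bar>f \<omega>\<bar> \<le> g \<omega>)"
        using quasi_surely_mono2[of "\<lambda>\<omega>. f \<omega> \<le> g \<omega>" "\<lambda>\<omega>. - f \<omega> \<le> g \<omega>" "\<lambda>\<omega>. \<bar>f \<omega>\<bar> \<le> g \<omega>"]
        by fastforce
    qed
    then show ?thesis using mem f by (auto simp: Upper_def le_L0)
  qed
  have least: "least ?L (cls g) (Upper ?L ?A) \<longleftrightarrow>
      cls g \<in> Upper ?L ?A \<and> (\<forall>h\<in>borel_measurable M. cls h \<in> Upper ?L ?A \<longrightarrow> qs (\<lambda>\<omega>. g \<omega> \<le> h \<omega>))"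
    if "g \<in> borel_measurable M" for g
  proof -
    have "Upper ?L ?A \<subseteq> cls ` borel_measurable M" using Y by (auto simp: Upper_def carrier_L0)
    then have "(\<forall>x\<in>Upper ?L ?A. le ?L (cls g) x) \<longleftrightarrow>
        (\<forall>h\<in>borel_measurable M. cls h \<in> Upper ?L ?A \<longrightarrow> le ?L (cls g) (cls h))"
      by (rule Ball_subset_image)
    also have "\<dots> \<longleftrightarrow> (\<forall>h\<in>borel_measurable M. cls h \<in> Upper ?L ?A \<longrightarrow> qs (\<lambda>\<omega>. g \<omega> \<le> h \<omega>))"
      using that by (simp add: le_L0)
    finally show ?thesis using Upper_closed[of ?L ?A] by (auto simp: least_def)
  qed
  have abs: "(\<lambda>\<omega>. \<bar>f \<omega>\<bar>) \<in> borel_measurable M" using f by measurable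
  have "least ?L (cls (\<lambda>\<omega>. \<bar>f \<omega>\<bar>)) (Upper ?L ?A)"
    using least[OF abs] Upper[OF abs] mem by (auto simp: Upper intro: quasi_surelyI)
  moreover have "x = cls (\<lambda>\<omega>. \<bar>f \<omega>\<bar>)" if x: "least ?L x (Upper ?L ?A)" for x
  proof -
    have "x \<in> Y" using x by (auto simp: least_def Upper_def)
    then obtain g where g: "g \<in> borel_measurable M" "x = cls g" using Y by (auto simp: carrier_L0)
    have "qs (\<lambda>\<omega>. \<bar>f \<omega>\<bar> \<le> g \<omega>)" using x g least Upper by auto
    moreover have "qs (\<lambda>\<omega>. g \<omega> \<le> \<bar>f \<omega>\<bar>)"
      using x g least[of g] Upper[OF abs] mem abs by (auto intro: quasi_surelyI)
    ultimately have "qs (\<lambda>\<omega>. g \<omega> = \<bar>f \<omega>\<bar>)"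
      using quasi_surely_mono2[of "\<lambda>\<omega>. \<bar>f \<omega>\<bar> \<le> g \<omega>" "\<lambda>\<omega>. g \<omega> \<le> \<bar>f \<omega>\<bar>" "\<lambda>\<omega>. g \<omega> = \<bar>f \<omega>\<bar>"]
      by force
    then show ?thesis using g abs by (simp add: qs_class_eq_iff)
  qed
  ultimately have "(SOME x. least ?L x (Upper ?L ?A)) = cls (\<lambda>\<omega>. \<bar>f \<omega>\<bar>)" by (rule some_equality)
  then show ?thesis using f by (simp add: vabs_def join_def sup_def vscale_L0)
qed

lemma vabs_L0_full:
  "f \<in> borel_measurable M \<Longrightarrow> vabs (L0 M P) (cls f) = cls (\<lambda>\<omega>. \<bar>f \<omega>\<bar>)"
proof -
  assume f: "f \<in> borel_measurable M"
  have eq: "L0 M P\<lparr>carrier := carrier (L0 M P)\<rparr> = L0 M P" by (simp add: L0_def)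
  show ?thesis
    using vabs_L0[of "carrier (L0 M P)" f] f unfolding eq by (simp add: carrier_L0)
qed

end

section \<open>Banach lattices that are ideals containing the bounded classes\<close>

locale quasi_sure_banach_lattice = quasi_sure M P + banach_lattice "L0 M P\<lparr>carrier := X\<rparr>" N
  for M :: "'a measure" and P X N +
  assumes P_nonempty: "P \<noteq> {}" and ideal: "lattice_ideal (L0 M P) X" and Linfty_X: "Linfty M P \<subseteq> X"
begin

abbreviation B :: "('a \<Rightarrow> real) set ordered_space" where "B \<equiv> L0 M P\<lparr>carrier := X\<rparr>"

lemma X_subset: "X \<subseteq> carrier (L0 M P)"
  using ideal by (simp add: lattice_ideal_def)

lemma X_cases:
  assumes "x \<in> X" obtains f where "f \<in> borel_measurable M" "x = cls f"
  using assms X_subset by (auto simp: carrier_L0)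

lemmas B_simps = vplus_L0 vscale_L0 vzero_L0 le_L0

lemma vminus_B:
  "\<lbrakk>f \<in> borel_measurable M; g \<in> borel_measurable M\<rbrakk> \<Longrightarrow> vminus B (cls f) (cls g) = cls (\<lambda>\<omega>. f \<omega> - g \<omega>)"
  by (simp add: vminus_def B_simps)

lemma dominated_mem_X:
  assumes "f \<in> borel_measurable M" "g \<in> borel_measurable M" "cls g \<in> X" "qs (\<lambda>\<omega>. \<bar>f \<omega>\<bar> \<le> \<bar>g \<omega>\<bar>)"
  shows "cls f \<in> X"
proof -
  have "le (L0 M P) (vabs (L0 M P) (cls f)) (vabs (L0 M P) (cls g))"
    using assms by (simp add: vabs_L0_full le_L0)
  moreover have "cls f \<in> carrier (L0 M P)" using assms by (simp add: carrier_L0)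
  ultimately show ?thesis using ideal assms(3) unfolding lattice_ideal_def by blast
qed

lemma one_mem_X: "cls (\<lambda>_. 1) \<in> X"
proof -
  have eq: "cls (indicat_real (space M)) = cls (\<lambda>_. 1)"
    by (subst qs_class_eq_iff) (auto intro: quasi_surelyI)
  have "le (L0 M P) (vabs (L0 M P) (cls (\<lambda>_. 1))) (vscale (L0 M P) 1 (cls (\<lambda>_. 1)))"
    by (simp add: vabs_L0_full vscale_L0 le_L0 quasi_surelyI)
  then have "cls (\<lambda>_. 1) \<in> Linfty M P"
    by (auto simp: Linfty_def carrier_L0 eq intro!: exI[of _ "1::real"])
  then show ?thesis using Linfty_X by blast
qed

lemma bounded_mem_X:
  assumes f: "f \<in> borel_measurable M" and b: "\<And>\<omega>. \<bar>f \<omega>\<bar> \<le> b"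
  shows "cls f \<in> X"
proof (rule dominated_mem_X[OF f])
  have "vscale B b (cls (\<lambda>_. 1)) \<in> X" using scale_closed[of "cls (\<lambda>_. 1)"] one_mem_X by simp
  then show "cls (\<lambda>_. b) \<in> X" by (simp add: B_simps)
  show "qs (\<lambda>\<omega>. \<bar>f \<omega>\<bar> \<le> \<bar>b\<bar>)" using b by (intro quasi_surelyI) (meson abs_ge_self order_trans)
qed simp

lemma vabs_B:
  assumes "f \<in> borel_measurable M" "cls f \<in> X"
  shows "vabs B (cls f) = cls (\<lambda>\<omega>. \<bar>f \<omega>\<bar>)"
proof (rule vabs_L0[OF X_subset assms])
  show "cls (\<lambda>\<omega>. - f \<omega>) \<in> X" "cls (\<lambda>\<omega>. \<bar>f \<omega>\<bar>) \<in> X"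
    using assms by (auto intro!: dominated_mem_X[OF _ assms] quasi_surelyI)
qed

lemma norm_mono_qs:
  assumes "f \<in> borel_measurable M" "g \<in> borel_measurable M" "cls f \<in> X" "cls g \<in> X"
    and "qs (\<lambda>\<omega>. \<bar>f \<omega>\<bar> \<le> \<bar>g \<omega>\<bar>)"
  shows "N (cls f) \<le> N (cls g)"
  using assms by (intro norm_mono) (auto simp: vabs_B le_L0)

text \<open>A constant majorises \<open>f\<close>, and the norm is monotone. This turns uniform
  approximation of representatives into approximation in the given norm.\<close>

lemma norm_bounded:
  assumes f: "f \<in> borel_measurable M" and b: "\<And>\<omega>. \<bar>f \<omega>\<bar> \<le> b"
  shows "N (cls f) \<le> b * N (cls (\<lambda>_. 1))"
proof -
  have "0 \<le> b" using b by (meson abs_ge_zero order_trans)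
  have "N (cls f) \<le> N (cls (\<lambda>_. b))"
    using b \<open>0 \<le> b\<close> by (intro norm_mono_qs f bounded_mem_X[of _ b] quasi_surelyI) auto
  also have "\<dots> = b * N (cls (\<lambda>_. 1))"
    using norm_scale[of "cls (\<lambda>_. 1)" b] one_mem_X \<open>0 \<le> b\<close> by (simp add: B_simps)
  finally show ?thesis .
qed

lemma pos_cone_B: "f \<in> borel_measurable M \<Longrightarrow> cls f \<in> pos_cone B \<longleftrightarrow> cls f \<in> X \<and> qs (\<lambda>\<omega>. 0 \<le> f \<omega>)"
  by (simp add: pos_cone_def B_simps)

lemma closure_of_norm_iff:
  assumes "C \<subseteq> X"
  shows "x \<in> norm_topology B N closure_of C \<longleftrightarrow> x \<in> X \<and> (\<forall>e>0. \<exists>c\<in>C. N (vminus B x c) < e)"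
  unfolding norm_topology_eq norm.metric_closure_of norm.in_mball
  using assms by (auto simp: norm_dist_def subset_iff)

section \<open>The Kreps-Yan property and domination\<close>

lemma pos_coneE:
  assumes "x \<in> pos_cone B"
  obtains f where "f \<in> borel_measurable M" "x = cls f" "cls f \<in> X" "qs (\<lambda>\<omega>. 0 \<le> f \<omega>)"
proof -
  obtain f where "f \<in> borel_measurable M" "x = cls f"
    using assms by (auto simp: pos_cone_def elim: X_cases)
  with assms that show ?thesis by (simp add: pos_cone_B)
qed

section \<open>From the Kreps-Yan property to domination\<close>

lemma zero_mem_pos_cone: "\<zero>\<^bsub>B\<^esub> \<in> pos_cone B"
  using zero_closed by (simp add: pos_cone_B vzero_L0 quasi_surelyI)

text \<open>The negative cone is admissible in the Kreps-Yan property. If a positive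
  \<open>x\<close> is within \<open>e\<close> of \<open>(-1) \<odot> a\<close> with \<open>a\<close>
  positive, then \<open>x\<close> is below \<open>x \<oplus> a\<close>, and monotonicity of the norm
  gives \<open>N x < e\<close>.\<close>

lemma neg_pos_cone_closed:
  defines "C \<equiv> (\<lambda>x. (-1) \<odot>\<^bsub>B\<^esub> x) ` pos_cone B"
  shows "locally_convex_solid.convex_cone_in B C"
    and "(norm_topology B N closure_of C) \<inter> pos_cone B = {\<zero>\<^bsub>B\<^esub>}"
proof -
  interpret lcs: locally_convex_solid B "norm_topology B N"
    by (rule locally_convex_solid_norm_topology)
  have CX: "C \<subseteq> X" using scale_closed by (auto simp: C_def pos_cone_def)
  have plus: "x \<oplus>\<^bsub>B\<^esub> y \<in> pos_cone B" if xy: "x \<in> pos_cone B" "y \<in> pos_cone B" for x y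
  proof -
    obtain f g where f: "f \<in> borel_measurable M" "x = cls f" "qs (\<lambda>\<omega>. 0 \<le> f \<omega>)"
      and g: "g \<in> borel_measurable M" "y = cls g" "qs (\<lambda>\<omega>. 0 \<le> g \<omega>)"
      using xy by (metis pos_coneE)
    have "x \<oplus>\<^bsub>B\<^esub> y \<in> carrier B" using xy by (intro plus_closed) (auto simp: pos_cone_def)
    moreover have "qs (\<lambda>\<omega>. 0 \<le> f \<omega> + g \<omega>)" by (rule quasi_surely_mono2[OF f(3) g(3)]) simp
    ultimately show ?thesis using f g by (simp add: vplus_L0 pos_cone_B)
  qed
  have scale: "t \<odot>\<^bsub>B\<^esub> x \<in> pos_cone B" if x: "x \<in> pos_cone B" and t: "0 \<le> t" for x t
    using x scale_mono[of "\<zero>\<^bsub>B\<^esub>" x t, unfolded scale_zero] scale_closed[of x t] t zero_closed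
    by (auto simp: pos_cone_def)
  show "lcs.convex_cone_in C"
    unfolding lcs.convex_cone_in_def
  proof (intro conjI ballI allI impI)
    show "C \<subseteq> carrier B" using CX by simp
    show "C \<noteq> {}" using zero_mem_pos_cone by (auto simp: C_def)
    fix x y assume "x \<in> C" "y \<in> C"
    then obtain a b where ab: "a \<in> pos_cone B" "b \<in> pos_cone B" "x = (-1) \<odot>\<^bsub>B\<^esub> a" "y = (-1) \<odot>\<^bsub>B\<^esub> b"
      by (auto simp: C_def)
    then have "x \<oplus>\<^bsub>B\<^esub> y = (-1) \<odot>\<^bsub>B\<^esub> (a \<oplus>\<^bsub>B\<^esub> b)"
      using scale_plus[of a b "-1"] by (simp add: pos_cone_def)
    then show "x \<oplus>\<^bsub>B\<^esub> y \<in> C" unfolding C_def using plus[OF ab(1,2)] by (rule image_eqI)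
  next
    fix t :: real and x assume t: "0 \<le> t" and "x \<in> C"
    then obtain a where a: "a \<in> pos_cone B" "x = (-1) \<odot>\<^bsub>B\<^esub> a" by (auto simp: C_def)
    then have "t \<odot>\<^bsub>B\<^esub> x = (-1) \<odot>\<^bsub>B\<^esub> (t \<odot>\<^bsub>B\<^esub> a)"
      using scale_scale[of a] by (simp add: pos_cone_def)
    then show "t \<odot>\<^bsub>B\<^esub> x \<in> C" unfolding C_def using scale[OF a(1) t] by (rule image_eqI)
  qed
  have "x = \<zero>\<^bsub>B\<^esub>" if x: "x \<in> norm_topology B N closure_of C" "x \<in> pos_cone B" for x
  proof -
    obtain f where f: "f \<in> borel_measurable M" "x = cls f" "cls f \<in> X" "qs (\<lambda>\<omega>. 0 \<le> f \<omega>)"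
      using x(2) by (rule pos_coneE)
    have "N x \<le> 0 + e" if "0 < e" for e
    proof -
      obtain c where c: "c \<in> C" "N (x \<ominus>\<^bsub>B\<^esub> c) < e"
        using x(1) \<open>0 < e\<close> by (auto simp: closure_of_norm_iff[OF CX])
      obtain a where a: "a \<in> pos_cone B" "c = (-1) \<odot>\<^bsub>B\<^esub> a" using c by (auto simp: C_def)
      obtain g where g: "g \<in> borel_measurable M" "a = cls g" "qs (\<lambda>\<omega>. 0 \<le> g \<omega>)"
        using a(1) by (rule pos_coneE)
      have eq: "x \<ominus>\<^bsub>B\<^esub> c = cls (\<lambda>\<omega>. f \<omega> - (-1) * g \<omega>)"
        using a f g by (simp add: vscale_L0 vminus_B)
      have "x \<ominus>\<^bsub>B\<^esub> c \<in> carrier B"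
        using f c CX by (intro vminus_closed) auto
      then have "cls (\<lambda>\<omega>. f \<omega> - (-1) * g \<omega>) \<in> X" by (simp add: eq)
      moreover have "qs (\<lambda>\<omega>. \<bar>f \<omega>\<bar> \<le> \<bar>f \<omega> - (-1) * g \<omega>\<bar>)"
        by (rule quasi_surely_mono2[OF f(4) g(3)]) simp
      ultimately have "N (cls f) \<le> N (cls (\<lambda>\<omega>. f \<omega> - (-1) * g \<omega>))"
        using f(1,3) g(1) by (intro norm_mono_qs) auto
      then have "N x \<le> N (x \<ominus>\<^bsub>B\<^esub> c)" unfolding eq unfolding f(2) .
      then show ?thesis using c by simp
    qed
    then have "N x \<le> 0" by (rule field_le_epsilon)
    then show ?thesis using norm_eq_0[of x] norm_nonneg[of x] f by simp
  qed
  moreover have "\<zero>\<^bsub>B\<^esub> \<in> norm_topology B N closure_of C"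
  proof -
    have "\<zero>\<^bsub>B\<^esub> \<in> C"
      unfolding C_def by (rule image_eqI[OF _ zero_mem_pos_cone]) (simp only: scale_zero)
    moreover have "C \<subseteq> topspace (norm_topology B N)" using CX by (simp add: lcs.topspace_eq)
    ultimately show ?thesis using closure_of_subset by blast
  qed
  ultimately show "(norm_topology B N closure_of C) \<inter> pos_cone B = {\<zero>\<^bsub>B\<^esub>}"
    using zero_mem_pos_cone by blast
qed

lemma indicator_class_eq_0:
  assumes A: "A \<in> sets M" and "cls (indicat_real A) = \<zero>\<^bsub>B\<^esub>"
  shows "upper_prob P A = 0"
proof -
  have "qs (\<lambda>\<omega>. indicat_real A \<omega> = 0)"
    using assms by (simp add: vzero_L0 qs_class_eq_iff)
  then obtain A' where "A' \<in> sets M" "upper_prob P A' = 0" "\<forall>\<omega>\<in>space M - A'. indicat_real A \<omega> = 0"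
    by (auto simp: quasi_surely_def)
  moreover from this have "A \<subseteq> A'"
    using sets.sets_into_space[OF A] by (auto simp: indicator_def split: if_splits)
  ultimately show ?thesis using upper_prob_mono by blast
qed

text \<open>Linearity makes \<mu> finitely additive, and strict positivity makes its null sets
  quasi-surely null, which is what the Halmos-Savage argument asks for.\<close>

lemma kreps_yan_imp_dominated:
  assumes "locally_convex_solid.kreps_yan B (norm_topology B N)"
  shows "dominated M P"
proof -
  interpret lcs: locally_convex_solid B "norm_topology B N"
    by (rule locally_convex_solid_norm_topology)
  obtain \<xi> where \<xi>: "\<xi> \<in> lcs.topological_dual" "lcs.strictly_positive \<xi>"
    using assms neg_pos_cone_closed unfolding lcs.kreps_yan_def by blast
  have add: "\<xi> (x \<oplus>\<^bsub>B\<^esub> y) = \<xi> x + \<xi> y" if "x \<in> X" "y \<in> X" for x y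
    using \<xi>(1) that by (simp add: lcs.topological_dual_def)
  have "\<xi> (0 \<odot>\<^bsub>B\<^esub> \<zero>\<^bsub>B\<^esub>) = 0 * \<xi> \<zero>\<^bsub>B\<^esub>"
    using \<xi>(1) zero_closed unfolding lcs.topological_dual_def by blast
  then have zero: "\<xi> \<zero>\<^bsub>B\<^esub> = 0" by (simp only: scale_zero mult_zero_left)
  define \<mu> where "\<mu> A = \<xi> (cls (indicat_real A))" for A
  have mem: "cls (indicat_real A) \<in> X" if "A \<in> sets M" for A
    using that by (intro bounded_mem_X[of _ 1]) (auto simp: indicator_def)
  have pos: "cls (indicat_real A) \<in> pos_cone B" if "A \<in> sets M" for A
    using that mem by (simp add: pos_cone_B quasi_surelyI)
  have \<mu>_pos: "0 < \<mu> A" if "A \<in> sets M" "cls (indicat_real A) \<noteq> \<zero>\<^bsub>B\<^esub>" for A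
    using \<xi>(2) that pos by (simp add: lcs.strictly_positive_def \<mu>_def)
  have "\<exists>Q\<in>space (prob_algebra M). \<forall>A\<in>sets M. emeasure Q A = 0 \<longleftrightarrow> upper_prob P A = 0"
  proof (rule Halmos_Savage[OF P_nonempty P_prob])
    show "0 \<le> \<mu> A" if "A \<in> sets M" for A
      using \<mu>_pos[OF that] zero by (cases "cls (indicat_real A) = \<zero>\<^bsub>B\<^esub>") (auto simp: \<mu>_def)
    show "\<mu> (A \<union> A') = \<mu> A + \<mu> A'" if "A \<in> sets M" "A' \<in> sets M" "A \<inter> A' = {}" for A A'
    proof -
      have "indicat_real (A \<union> A') = (\<lambda>\<omega>. indicat_real A \<omega> + indicat_real A' \<omega>)"
        using that(3) by (auto simp: indicator_def fun_eq_iff)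
      then have "cls (indicat_real (A \<union> A')) = cls (indicat_real A) \<oplus>\<^bsub>B\<^esub> cls (indicat_real A')"
        using that by (simp add: vplus_L0)
      then show ?thesis using add mem that by (simp add: \<mu>_def)
    qed
    show "upper_prob P A = 0" if "A \<in> sets M" "\<mu> A = 0" for A
      using indicator_class_eq_0[OF that(1)] \<mu>_pos[OF that(1)] that(2) by force
  qed
  then show ?thesis by (auto simp: dominated_def)
qed

section \<open>From domination to the Kreps-Yan property\<close>

context
  fixes Q :: "'a measure" and C :: "('a \<Rightarrow> real) set set"
  assumes Q_prob: "Q \<in> space (prob_algebra M)"
    and Q_null: "\<And>A. A \<in> sets M \<Longrightarrow> emeasure Q A = 0 \<longleftrightarrow> upper_prob P A = 0"
    and cone: "locally_convex_solid.convex_cone_in B C"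
    and neg: "(\<lambda>x. (-1) \<odot>\<^bsub>B\<^esub> x) ` pos_cone B \<subseteq> C"
    and closure: "(norm_topology B N closure_of C) \<inter> pos_cone B = {\<zero>\<^bsub>B\<^esub>}"
begin

interpretation lcs: locally_convex_solid B "norm_topology B N"
  by (rule locally_convex_solid_norm_topology)

interpretation Q: prob_space Q
  using Q_prob by (simp add: space_prob_algebra)

lemma sets_Q [measurable_cong]: "sets Q = sets M"
  using Q_prob by (simp add: space_prob_algebra)

lemma space_Q: "space Q = space M"
  using sets_Q by (rule sets_eq_imp_space_eq)

lemma coneD:
  shows "C \<subseteq> X" and "C \<noteq> {}" and "\<And>x y. x \<in> C \<Longrightarrow> y \<in> C \<Longrightarrow> x \<oplus>\<^bsub>B\<^esub> y \<in> C"
    and "\<And>x t. x \<in> C \<Longrightarrow> 0 \<le> t \<Longrightarrow> t \<odot>\<^bsub>B\<^esub> x \<in> C"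
  using cone unfolding lcs.convex_cone_in_def by auto

lemma quasi_surely_imp_AE: "qs R \<Longrightarrow> AE \<omega> in Q. R \<omega>"
proof -
  assume "qs R"
  then obtain A where A: "A \<in> sets M" "upper_prob P A = 0" "\<forall>\<omega>\<in>space M - A. R \<omega>"
    by (auto simp: quasi_surely_def)
  show ?thesis by (rule AE_I'[of A]) (use A in \<open>auto simp: null_sets_def Q_null sets_Q space_Q\<close>)
qed

text \<open>Otherwise functions of this kind exist within \<open>(1/2) ^ k\<close> of
  \<open>C\<close> for every \<open>k\<close>. These sets decrease and are closed under midpoints
  because \<open>C\<close> is a convex cone, so they have an almost uniform limit. Cut off outside
  the good set \<open>D\<close>, it still has positive integral, and its class lies in the closure
  of \<open>C\<close>, against the hypothesis on that closure.\<close>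

lemma class_distance_pos:
  assumes "0 < \<epsilon>"
  shows "\<exists>\<delta>>0. \<forall>f\<in>borel_measurable M. (\<forall>\<omega>. 0 \<le> f \<omega> \<and> f \<omega> \<le> 1) \<longrightarrow> \<epsilon> \<le> (\<integral>\<omega>. f \<omega> \<partial>Q) \<longrightarrow>
    (\<forall>c\<in>C. \<delta> \<le> N (cls f \<ominus>\<^bsub>B\<^esub> c))"
proof (rule ccontr)
  assume contra: "\<not> ?thesis"
  define S where "S k = {f \<in> borel_measurable M. (\<forall>\<omega>. 0 \<le> f \<omega> \<and> f \<omega> \<le> 1) \<and> \<epsilon> \<le> (\<integral>\<omega>. f \<omega> \<partial>Q) \<and>
    (\<exists>c\<in>C. N (cls f \<ominus>\<^bsub>B\<^esub> c) \<le> (1/2) ^ k)}" for k :: nat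
  have SX: "cls f \<in> X" if "f \<in> S k" for f k
    using that by (intro bounded_mem_X[of _ 1]) (auto simp: S_def)
  have int: "integrable Q f" if "f \<in> borel_measurable M" "\<And>\<omega>. 0 \<le> f \<omega> \<and> f \<omega> \<le> 1" for f :: "'a \<Rightarrow> real"
    using that by (intro Q.integrable_const_bound[where B=1]) (auto simp: sets_Q cong: measurable_cong_sets)
  \<comment> \<open>The budget for the integral \<epsilon> is as follows: functions with values in
    [0, 1] lose at most \<epsilon> \<open>/ 2\<close> off \<open>D\<close>, and uniform
    approximation on \<open>D\<close> will cost \<epsilon> \<open>/ 4\<close>, so something positive
    remains.\<close>
  have "\<exists>g f D. (\<forall>i. g i \<in> S i) \<and> f \<in> borel_measurable Q \<and> D \<in> sets Q \<and>
    measure Q (space Q - D) \<le> \<epsilon> / 2 \<and> uniform_limit D g f sequentially"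
  proof (rule midpoint_convex_uniform_limit)
    show "prob_space Q" by unfold_locales
    show "0 < \<epsilon> / 2" using assms by simp
    show "S k \<noteq> {}" for k
    proof -
      have "\<exists>f\<in>borel_measurable M. (\<forall>\<omega>. 0 \<le> f \<omega> \<and> f \<omega> \<le> 1) \<and> \<epsilon> \<le> (\<integral>\<omega>. f \<omega> \<partial>Q) \<and>
          (\<exists>c\<in>C. \<not> \<delta> \<le> N (cls f \<ominus>\<^bsub>B\<^esub> c))" if "0 < \<delta>" for \<delta>
        using contra that by auto
      from this[of "(1/2) ^ k"] obtain f c where "f \<in> borel_measurable M" "\<forall>\<omega>. 0 \<le> f \<omega> \<and> f \<omega> \<le> 1" "\<epsilon> \<le> (\<integral>\<omega>. f \<omega> \<partial>Q)"
        "c \<in> C" "N (cls f \<ominus>\<^bsub>B\<^esub> c) \<le> (1/2) ^ k" by (auto simp: not_le intro: less_imp_le)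
      then have "f \<in> S k" unfolding S_def by blast
      then show ?thesis by blast
    qed
    show "S (Suc k) \<subseteq> S k" for k
    proof -
      have "(1/2) ^ Suc k \<le> (1/2 :: real) ^ k" by simp
      then show ?thesis unfolding S_def by (blast intro: order_trans)
    qed
    show "f \<in> borel_measurable Q" if "f \<in> S k" for f k
      using that by (simp add: S_def sets_Q cong: measurable_cong_sets)
    show "0 \<le> f x \<and> f x \<le> 1" if "f \<in> S k" for f k x using that by (simp add: S_def)
    show "(\<lambda>x. (f x + g x) / 2) \<in> S k" if fg: "f \<in> S k" "g \<in> S k" for f g k
    proof -
      obtain c d where c: "c \<in> C" "N (cls f \<ominus>\<^bsub>B\<^esub> c) \<le> (1/2) ^ k"
        and d: "d \<in> C" "N (cls g \<ominus>\<^bsub>B\<^esub> d) \<le> (1/2) ^ k"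
        using fg by (auto simp: S_def)
      have cX: "c \<in> carrier B" "d \<in> carrier B" "cls f \<in> carrier B" "cls g \<in> carrier B"
        using c d coneD(1) fg SX by auto
      have meas: "f \<in> borel_measurable M" "g \<in> borel_measurable M" using fg by (auto simp: S_def)
      have eq: "cls (\<lambda>x. (f x + g x) / 2) = (1/2) \<odot>\<^bsub>B\<^esub> (cls f \<oplus>\<^bsub>B\<^esub> cls g)"
        using meas by (simp add: B_simps)
      let ?u = "cls f \<ominus>\<^bsub>B\<^esub> c" and ?v = "cls g \<ominus>\<^bsub>B\<^esub> d"
      have uv: "?u \<in> carrier B" "?v \<in> carrier B" using cX vminus_closed by blast+
      have "cls (\<lambda>x. (f x + g x) / 2) \<ominus>\<^bsub>B\<^esub> (1/2) \<odot>\<^bsub>B\<^esub> (c \<oplus>\<^bsub>B\<^esub> d) = (1/2) \<odot>\<^bsub>B\<^esub> (?u \<oplus>\<^bsub>B\<^esub> ?v)"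
        unfolding eq using cX scale_vminus plus_vminus_plus plus_closed by metis
      then have "N (cls (\<lambda>x. (f x + g x) / 2) \<ominus>\<^bsub>B\<^esub> (1/2) \<odot>\<^bsub>B\<^esub> (c \<oplus>\<^bsub>B\<^esub> d))
          = \<bar>1/2\<bar> * N (?u \<oplus>\<^bsub>B\<^esub> ?v)"
        using norm_scale[OF plus_closed[OF uv]] by simp
      also have "\<dots> \<le> \<bar>1/2\<bar> * ((1/2) ^ k + (1/2) ^ k)"
        using norm_triangle[OF uv] c(2) d(2) by (intro mult_left_mono) linarith+
      also have "\<dots> = (1/2) ^ k" by simp
      finally have "\<exists>e\<in>C. N (cls (\<lambda>x. (f x + g x) / 2) \<ominus>\<^bsub>B\<^esub> e) \<le> (1/2) ^ k"
        by (rule bexI) (use coneD(3,4) c(1) d(1) in simp)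
      moreover have "\<epsilon> \<le> (\<integral>x. (f x + g x) / 2 \<partial>Q)"
      proof -
        have "integrable Q f" "integrable Q g" by (intro int; use fg in \<open>simp add: S_def\<close>)+
        moreover have "\<epsilon> \<le> (\<integral>x. f x \<partial>Q)" "\<epsilon> \<le> (\<integral>x. g x \<partial>Q)" using fg by (auto simp: S_def)
        ultimately show ?thesis by simp
      qed
      moreover have "\<forall>x. 0 \<le> (f x + g x) / 2 \<and> (f x + g x) / 2 \<le> 1"
      proof
        fix x
        have "0 \<le> f x" "f x \<le> 1" "0 \<le> g x" "g x \<le> 1" using fg by (auto simp: S_def)
        then show "0 \<le> (f x + g x) / 2 \<and> (f x + g x) / 2 \<le> 1" by simp
      qed
      ultimately show ?thesis unfolding S_def using meas by simp
    qed
  qed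
  then obtain g f D where g: "\<And>i. g i \<in> S i" and f': "f \<in> borel_measurable Q" and D': "D \<in> sets Q"
    and QD: "measure Q (space Q - D) \<le> \<epsilon> / 2" and lim: "uniform_limit D g f sequentially" by blast
  have f [measurable]: "f \<in> borel_measurable M" using f' by (simp add: sets_Q cong: measurable_cong_sets)
  have D [measurable]: "D \<in> sets M" using D' by (simp add: sets_Q)
  have g_meas [measurable]: "g i \<in> borel_measurable M" for i using g by (auto simp: S_def)
  have g01: "0 \<le> g i x" "g i x \<le> 1" for i x using g[of i] by (auto simp: S_def)
  have f01: "0 \<le> f x" "f x \<le> 1" if "x \<in> D" for x
  proof -
    have "(\<lambda>i. g i x) \<longlonglongrightarrow> f x" using lim that by (rule tendsto_uniform_limitI)
    then show "0 \<le> f x" "f x \<le> 1"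
      using g01 by (auto intro: LIMSEQ_le_const LIMSEQ_le_const2)
  qed
  \<comment> \<open>The values of \<open>f\<close> are controlled on \<open>D\<close> only.\<close>
  define h where "h x = indicat_real D x * f x" for x
  have h [measurable]: "h \<in> borel_measurable M" unfolding h_def by measurable
  have h01: "0 \<le> h x" "h x \<le> 1" for x using f01[of x] by (auto simp: h_def indicator_def)
  have near: "\<exists>i. (\<forall>x\<in>D. \<bar>g i x - f x\<bar> < e) \<and> (1/2) ^ i < e" if "0 < e" for e :: real
  proof -
    have "\<forall>\<^sub>F i in sequentially. \<forall>x\<in>D. dist (g i x) (f x) < e"
      using uniform_limitD[OF lim that] .
    moreover have "\<forall>\<^sub>F i in sequentially. (1/2) ^ i < e"
      using order_tendstoD(2)[OF LIMSEQ_power_zero[of "1/2 :: real"] that] by simp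
    ultimately have "\<forall>\<^sub>F i in sequentially. (\<forall>x\<in>D. dist (g i x) (f x) < e) \<and> (1/2) ^ i < e"
      by (rule eventually_conj)
    then show ?thesis by (auto simp: dist_real_def dest: eventually_happens)
  qed
  have "cls h \<in> X" using h01 by (intro bounded_mem_X[of _ 1] h) auto
  have ih: "integrable Q h" using h01 by (intro int) auto
  have ind: "integrable Q (indicat_real (space Q - D))"
    using D' by (intro integrable_real_indicator) (auto simp: Q.emeasure_eq_measure)
  have "0 < (\<integral>x. h x \<partial>Q)"
  proof -
    obtain i where i: "\<forall>x\<in>D. \<bar>g i x - f x\<bar> < \<epsilon> / 4" using near[of "\<epsilon> / 4"] assms by auto
    have "\<epsilon> \<le> (\<integral>x. g i x \<partial>Q)" using g[of i] by (simp add: S_def)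
    also have "\<dots> \<le> (\<integral>x. h x + indicator (space Q - D) x + \<epsilon> / 4 \<partial>Q)"
    proof (rule integral_mono)
      show "integrable Q (g i)" using g01 by (intro int) auto
      show "integrable Q (\<lambda>x. h x + indicat_real (space Q - D) x + \<epsilon> / 4)"
        using ih ind by simp
      fix x assume "x \<in> space Q"
      moreover have "g i x \<le> f x + \<epsilon> / 4" if "x \<in> D"
      proof -
        have "\<bar>g i x - f x\<bar> < \<epsilon> / 4" using i that by blast
        then show ?thesis by linarith
      qed
      ultimately show "g i x \<le> h x + indicat_real (space Q - D) x + \<epsilon> / 4"
        using g01[of i x] assms by (auto simp: h_def indicator_def)
    qed
    also have "\<dots> = (\<integral>x. h x \<partial>Q) + measure Q (space Q - D) + \<epsilon> / 4"
      using ih ind D' by (simp add: Q.prob_space)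
    finally show ?thesis using QD assms by simp
  qed
  moreover have "cls h \<in> norm_topology B N closure_of C"
    unfolding closure_of_norm_iff[OF coneD(1)]
  proof (intro conjI allI impI)
    show "cls h \<in> X" by fact
    fix e :: real assume e: "0 < e"
    let ?n = "N (cls (\<lambda>_. 1))"
    have n: "0 \<le> ?n" using norm_nonneg one_mem_X by simp
    \<comment> \<open>One bound serves for the uniform error on \<open>D\<close>, which the norm
      multiplies by at most \<open>?n\<close>, and for the distance \<open>(1/2) ^ i\<close> from
      \<open>C\<close>; together they amount to \<open>e / 2\<close>.\<close>
    define e' where "e' = e / 2 / (?n + 1)"
    have "?n + 1 \<noteq> 0" using n by linarith
    then have "e' * (?n + 1) = e / 2" unfolding e'_def by (metis nonzero_eq_divide_eq)
    then have e': "0 < e'" "e' * (?n + 1) < e" using e n by (simp add: e'_def, linarith)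
    obtain i where i: "\<forall>x\<in>D. \<bar>g i x - f x\<bar> < e'" "(1/2) ^ i < e'" using near[OF e'(1)] by blast
    obtain c where c: "c \<in> C" "N (cls (g i) \<ominus>\<^bsub>B\<^esub> c) \<le> (1/2) ^ i" using g[of i] by (auto simp: S_def)
    obtain r where r: "r \<in> borel_measurable M" "c = cls r" using c(1) coneD(1) X_cases by blast
    \<comment> \<open>The part of \<open>g i\<close> off \<open>D\<close> need not be small in norm.
      It is positive, however, and \<open>C\<close> contains the negative cone, so it may be
      subtracted from \<open>c\<close> without leaving \<open>C\<close>.\<close>
    define p where "p x = g i x - indicat_real D x * g i x" for x
    have p [measurable]: "p \<in> borel_measurable M" unfolding p_def by measurable
    have p01: "0 \<le> p x" "p x \<le> 1" for x using g01[of i x] by (auto simp: p_def indicator_def)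
    have "cls p \<in> pos_cone B"
      using p01 by (auto simp: pos_cone_B intro!: bounded_mem_X[of _ 1] quasi_surelyI)
    then have "(-1) \<odot>\<^bsub>B\<^esub> cls p \<in> C" using neg by blast
    with c(1) have c': "c \<oplus>\<^bsub>B\<^esub> (-1) \<odot>\<^bsub>B\<^esub> cls p \<in> C" by (rule coneD(3))
    define q where "q x = indicat_real D x * (f x - g i x)" for x
    have q [measurable]: "q \<in> borel_measurable M" unfolding q_def by measurable
    have qb: "\<bar>q x\<bar> \<le> e'" for x
      using i(1) e' by (auto simp: q_def indicator_def abs_minus_commute intro: less_imp_le)
    have eq: "cls h \<ominus>\<^bsub>B\<^esub> (c \<oplus>\<^bsub>B\<^esub> (-1) \<odot>\<^bsub>B\<^esub> cls p) = cls q \<oplus>\<^bsub>B\<^esub> (cls (g i) \<ominus>\<^bsub>B\<^esub> c)"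
      using r by (simp add: vminus_B B_simps) (simp add: h_def p_def q_def algebra_simps)
    have "cls q \<in> carrier B" "cls (g i) \<in> carrier B" "c \<in> carrier B"
      using bounded_mem_X[OF q qb] SX[OF g] c(1) coneD(1) by auto
    then have "cls q \<in> carrier B" "cls (g i) \<ominus>\<^bsub>B\<^esub> c \<in> carrier B"
      using vminus_closed by blast+
    then have "N (cls h \<ominus>\<^bsub>B\<^esub> (c \<oplus>\<^bsub>B\<^esub> (-1) \<odot>\<^bsub>B\<^esub> cls p)) \<le> N (cls q) + N (cls (g i) \<ominus>\<^bsub>B\<^esub> c)"
      unfolding eq by (rule norm_triangle)
    also have "\<dots> \<le> e' * ?n + e'"
      using norm_bounded[OF q qb] c(2) i(2) by simp
    also have "\<dots> < e" using e' by (simp add: distrib_left)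
    finally show "\<exists>c\<in>C. N (cls h \<ominus>\<^bsub>B\<^esub> c) < e" using c' by blast
  qed
  moreover have "cls h \<in> pos_cone B"
    using \<open>cls h \<in> X\<close> h01 by (simp add: pos_cone_B quasi_surelyI)
  ultimately have "cls h = \<zero>\<^bsub>B\<^esub>" using closure by blast
  then have "qs (\<lambda>x. h x = 0)" by (simp add: vzero_L0 qs_class_eq_iff)
  \<comment> \<open>This uses that \<open>Q\<close> vanishes on quasi-surely null sets.\<close>
  then have "(\<integral>x. h x \<partial>Q) = 0" by (intro integral_eq_zero_AE quasi_surely_imp_AE)
  with \<open>0 < (\<integral>x. h x \<partial>Q)\<close> show False by simp
qed

text \<open>For each \<open>n\<close>, separate from \<open>C\<close> the functions in [0, 1] with
  integral at least \<open>1 / (n + 1)\<close>, and add the functionals with weights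
  \<open>(1/2) ^ n\<close>. Each of them is nonnegative on the positive cone, since \<open>C\<close>
  contains its negative. A nonzero positive element dominates a multiple of the indicator of a set
  of positive \<open>Q\<close> measure, and this indicator is covered by some
  \<open>n\<close>.\<close>

lemma Kreps_Yan_functional:
  "\<exists>\<xi>\<in>locally_convex_solid.topological_dual B (norm_topology B N).
     locally_convex_solid.strictly_positive B \<xi> \<and> (\<forall>x\<in>C. \<xi> x \<le> 0)"
proof -
  define F where "F n = {f \<in> borel_measurable M. (\<forall>\<omega>. 0 \<le> f \<omega> \<and> f \<omega> \<le> 1) \<and>
    1 / real (Suc n) \<le> (\<integral>\<omega>. f \<omega> \<partial>Q)}" for n
  have FX: "cls f \<in> X" if "f \<in> F n" for f n
    using that by (intro bounded_mem_X[of _ 1]) (auto simp: F_def)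
  define separates where "separates n \<delta> \<xi> \<longleftrightarrow> 0 < \<delta> \<and> linear_functional \<xi> \<and>
    (\<forall>x\<in>carrier B. \<bar>\<xi> x\<bar> \<le> N x) \<and> (\<forall>c\<in>C. \<xi> c \<le> 0) \<and> (\<forall>f\<in>F n. \<delta> \<le> \<xi> (cls f))" for n \<delta> \<xi>
  have "\<exists>\<delta> \<xi>. separates n \<delta> \<xi>" for n
  proof -
    obtain \<delta> where \<delta>: "0 < \<delta>" "\<forall>f\<in>borel_measurable M. (\<forall>\<omega>. 0 \<le> f \<omega> \<and> f \<omega> \<le> 1) \<longrightarrow>
        1 / real (Suc n) \<le> (\<integral>\<omega>. f \<omega> \<partial>Q) \<longrightarrow> (\<forall>c\<in>C. \<delta> \<le> N (cls f \<ominus>\<^bsub>B\<^esub> c))"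
      using class_distance_pos[of "1 / real (Suc n)"] by auto
    have "\<exists>\<xi>. linear_functional \<xi> \<and> (\<forall>x\<in>carrier B. \<bar>\<xi> x\<bar> \<le> N x) \<and>
        (\<forall>c\<in>C. \<xi> c \<le> 0) \<and> (\<forall>x\<in>cls ` F n. \<delta> \<le> \<xi> x)"
    proof (rule separation)
      show "cls ` F n \<subseteq> carrier B" using FX by auto
      have "(\<lambda>_. 1) \<in> F n" by (simp add: F_def Q.prob_space)
      then show "cls ` F n \<noteq> {}" by blast
      show "C \<subseteq> carrier B" using coneD(1) by simp
      show "C \<noteq> {}" "\<And>x y. x \<in> C \<Longrightarrow> y \<in> C \<Longrightarrow> x \<oplus>\<^bsub>B\<^esub> y \<in> C"
        "\<And>x t. x \<in> C \<Longrightarrow> 0 \<le> t \<Longrightarrow> t \<odot>\<^bsub>B\<^esub> x \<in> C"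
        using coneD by blast+
      show "\<delta> \<le> N (x \<ominus>\<^bsub>B\<^esub> c)" if "x \<in> cls ` F n" "c \<in> C" for x c
        using that \<delta>(2) by (auto simp: F_def)
      fix x y and t :: real assume "x \<in> cls ` F n" "y \<in> cls ` F n" and t: "0 \<le> t" "t \<le> 1"
      then obtain f g where fg: "f \<in> F n" "g \<in> F n" "x = cls f" "y = cls g" by blast
      then have meas: "f \<in> borel_measurable M" "g \<in> borel_measurable M" by (auto simp: F_def)
      define h where "h \<omega> = (1 - t) * f \<omega> + t * g \<omega>" for \<omega>
      have "integrable Q f" "integrable Q g"
        by (intro Q.integrable_const_bound[where B=1]; use fg in \<open>simp add: F_def sets_Q cong: measurable_cong_sets\<close>)+
      then have "(\<integral>\<omega>. h \<omega> \<partial>Q) = (1 - t) * (\<integral>\<omega>. f \<omega> \<partial>Q) + t * (\<integral>\<omega>. g \<omega> \<partial>Q)"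
        by (simp add: h_def)
      also have "\<dots> \<ge> 1 / real (Suc n)"
      proof -
        have "(1 - t) * (1 / real (Suc n)) \<le> (1 - t) * (\<integral>\<omega>. f \<omega> \<partial>Q)"
          "t * (1 / real (Suc n)) \<le> t * (\<integral>\<omega>. g \<omega> \<partial>Q)"
          using fg t unfolding F_def by (intro mult_left_mono; simp)+
        moreover have "(1 - t) * (1 / real (Suc n)) + t * (1 / real (Suc n)) = 1 / real (Suc n)"
          by (simp only: distrib_right[symmetric]) simp
        ultimately show ?thesis by linarith
      qed
      finally have "1 / real (Suc n) \<le> (\<integral>\<omega>. h \<omega> \<partial>Q)" .
      moreover have "0 \<le> h \<omega> \<and> h \<omega> \<le> 1" for \<omega>
        using fg t unfolding h_def F_def by (auto intro!: convex_bound_le)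
      moreover have "h \<in> borel_measurable M" using meas unfolding h_def by measurable
      ultimately have "h \<in> F n" by (simp add: F_def)
      moreover have "(1 - t) \<odot>\<^bsub>B\<^esub> x \<oplus>\<^bsub>B\<^esub> t \<odot>\<^bsub>B\<^esub> y = cls h"
        using fg meas by (simp add: B_simps h_def[abs_def])
      ultimately show "(1 - t) \<odot>\<^bsub>B\<^esub> x \<oplus>\<^bsub>B\<^esub> t \<odot>\<^bsub>B\<^esub> y \<in> cls ` F n" by simp
    qed
    then obtain \<xi> where "linear_functional \<xi>" "\<forall>x\<in>carrier B. \<bar>\<xi> x\<bar> \<le> N x"
      "\<forall>c\<in>C. \<xi> c \<le> 0" "\<forall>x\<in>cls ` F n. \<delta> \<le> \<xi> x" by blast
    with \<delta>(1) have "separates n \<delta> \<xi>" by (simp add: separates_def)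
    then show ?thesis by blast
  qed
  then obtain \<delta> \<xi> where sep: "\<And>n. separates n (\<delta> n) (\<xi> n)" by metis
  have \<delta>: "0 < \<delta> n" and lin: "linear_functional (\<xi> n)" for n
    using sep[of n] by (simp_all only: separates_def)
  have bound: "\<bar>\<xi> n x\<bar> \<le> N x" if "x \<in> X" for n x
    using sep[of n] that by (simp add: separates_def)
  have nonpos: "\<xi> n c \<le> 0" if "c \<in> C" for n c
    using sep[of n] that by (simp add: separates_def)
  have \<delta>_le: "\<delta> n \<le> \<xi> n (cls f)" if "f \<in> F n" for n f
    using sep[of n] that by (simp add: separates_def)
  have lin_add: "\<xi> n (x \<oplus>\<^bsub>B\<^esub> y) = \<xi> n x + \<xi> n y" if "x \<in> X" "y \<in> X" for n x y
    using lin[of n] that by (simp add: linear_functional_def)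
  have lin_scale: "\<xi> n (t \<odot>\<^bsub>B\<^esub> x) = t * \<xi> n x" if "x \<in> X" for n t x
    using lin[of n] that by (simp add: linear_functional_def)
  have summable: "summable (\<lambda>n. (1/2) ^ n * \<xi> n x)" if "x \<in> X" for x
  proof (rule summable_comparison_test')
    show "summable (\<lambda>n. (1/2) ^ n * N x)" by (intro summable_mult2 summable_geometric) simp
    show "norm ((1/2) ^ n * \<xi> n x) \<le> (1/2) ^ n * N x" for n
      using bound[OF that, of n] by (simp add: abs_mult)
  qed
  define \<Xi> where "\<Xi> x = (\<Sum>n. (1/2) ^ n * \<xi> n x)" for x
  have add: "\<Xi> (x \<oplus>\<^bsub>B\<^esub> y) = \<Xi> x + \<Xi> y" if "x \<in> X" "y \<in> X" for x y
    using suminf_add[OF summable[OF that(1)] summable[OF that(2)]]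
    by (simp only: \<Xi>_def lin_add[OF that] distrib_left)
  have scale: "\<Xi> (t \<odot>\<^bsub>B\<^esub> x) = t * \<Xi> x" if "x \<in> X" for t x
    using suminf_mult[OF summable[OF that], of t]
    by (simp only: \<Xi>_def lin_scale[OF that] mult.left_commute)
  have \<Xi>_bound: "\<bar>\<Xi> x\<bar> \<le> 2 * N x" if "x \<in> X" for x
  proof -
    have s: "(\<lambda>n. (1/2) ^ n * N x) sums (2 * N x)"
      using sums_mult2[OF geometric_sums[of "1/2 :: real"], of "N x"] by simp
    have "norm (\<Sum>n. (1/2) ^ n * \<xi> n x) \<le> (\<Sum>n. (1/2) ^ n * N x)"
      by (rule norm_suminf_le[OF _ sums_summable[OF s]]) (use bound[OF that] in \<open>simp add: abs_mult\<close>)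
    then show ?thesis using sums_unique[OF s] by (simp add: \<Xi>_def)
  qed
  \<comment> \<open>By \<open>\<Xi>_bound\<close> the functional is Lipschitz with constant 2, hence
    the radius \<open>e / 2\<close> below.\<close>
  have cont: "continuous_map (norm_topology B N) euclideanreal \<Xi>"
    unfolding continuous_map_def norm_topology_eq norm.topspace_mtopology
  proof (intro conjI allI impI)
    fix U :: "real set" assume U: "openin euclideanreal U"
    show "openin norm.mtopology {x \<in> carrier B. \<Xi> x \<in> U}"
      unfolding norm.openin_mtopology
    proof (intro conjI allI impI)
      fix x assume "x \<in> {x \<in> carrier B. \<Xi> x \<in> U}"
      then have x: "x \<in> carrier B" "\<Xi> x \<in> U" by auto
      then obtain e where e: "0 < e" "ball (\<Xi> x) e \<subseteq> U" using U by (auto simp: open_contains_ball)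
      have "norm.mball x (e / 2) \<subseteq> {x \<in> carrier B. \<Xi> x \<in> U}"
      proof
        fix y assume "y \<in> norm.mball x (e / 2)"
        then have y: "y \<in> carrier B" "N (y \<ominus>\<^bsub>B\<^esub> x) < e / 2" by (simp_all only: in_mball)
        then have yx: "y \<ominus>\<^bsub>B\<^esub> x \<in> X" using x vminus_closed[of y x] by simp
        have "\<Xi> ((y \<ominus>\<^bsub>B\<^esub> x) \<oplus>\<^bsub>B\<^esub> x) = \<Xi> (y \<ominus>\<^bsub>B\<^esub> x) + \<Xi> x"
          using yx x by (intro add) auto
        then have "\<bar>\<Xi> y - \<Xi> x\<bar> < e"
          using \<Xi>_bound[OF yx] y(2) vminus_plus_cancel[OF y(1) x(1)] by (simp only:)
        then show "y \<in> {x \<in> carrier B. \<Xi> x \<in> U}"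
          using e(2) y(1) by (auto simp: dist_real_def abs_minus_commute subset_iff)
      qed
      then show "\<exists>r>0. norm.mball x r \<subseteq> {x \<in> carrier B. \<Xi> x \<in> U}" using e(1) by (intro exI[of _ "e / 2"]) simp
    qed auto
  qed auto
  have pos: "0 \<le> \<xi> n x" if x: "x \<in> pos_cone B" for n x
  proof -
    have "x \<in> X" using x by (simp add: pos_cone_def)
    moreover have "(-1) \<odot>\<^bsub>B\<^esub> x \<in> C" using neg x by blast
    ultimately show ?thesis using nonpos[of "(-1) \<odot>\<^bsub>B\<^esub> x" n] lin_scale[of x n "-1"] by simp
  qed
  have "0 < \<Xi> x" if x: "x \<in> pos_cone B" "x \<noteq> \<zero>\<^bsub>B\<^esub>" for x
  proof -
    obtain f where f: "f \<in> borel_measurable M" "x = cls f" "cls f \<in> X" "qs (\<lambda>\<omega>. 0 \<le> f \<omega>)"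
      using x(1) by (rule pos_coneE)
    \<comment> \<open>These sets exhaust the points where \<open>f\<close> is positive. If all were
      null for \<open>Q\<close>, they would be quasi-surely null, and \<open>x\<close> would be
      zero.\<close>
    define A where "A m = {\<omega> \<in> space M. 1 / real (Suc m) < f \<omega>}" for m
    have A [measurable]: "A m \<in> sets M" for m using f(1) unfolding A_def by measurable
    have "\<exists>m. emeasure Q (A m) \<noteq> 0"
    proof (rule ccontr)
      assume "\<not> ?thesis"
      then have "emeasure Q (\<Union>m. A m) = 0"
        using A by (intro emeasure_UN_eq_0) (auto simp: sets_Q)
      then have null: "upper_prob P (\<Union>m. A m) = 0" using Q_null[of "\<Union>m. A m"] by simp
      have "qs (\<lambda>\<omega>. f \<omega> \<le> 0)"
        unfolding quasi_surely_def
      proof (intro bexI conjI ballI)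
        fix \<omega> assume \<omega>: "\<omega> \<in> space M - (\<Union>m. A m)"
        then have "f \<omega> \<le> inverse (real (Suc m))" for m by (auto simp: A_def not_less inverse_eq_divide)
        then show "f \<omega> \<le> 0" using LIMSEQ_le_const[OF LIMSEQ_inverse_real_of_nat, of "f \<omega>"] by auto
      qed (use null in auto)
      then have "qs (\<lambda>\<omega>. f \<omega> = 0)" by (rule quasi_surely_mono2[OF f(4)]) simp
      then show False using x(2) f by (simp add: vzero_L0 qs_class_eq_iff)
    qed
    then obtain m where m: "0 < measure Q (A m)"
      by (auto simp: Q.emeasure_eq_measure zero_less_measure_iff)
    then obtain n where n: "1 / real (Suc n) \<le> measure Q (A m)"
      using reals_Archimedean[OF m] by (auto simp: inverse_eq_divide intro: less_imp_le)
    \<comment> \<open>On \<open>A m\<close> the function \<open>f\<close> exceeds \<open>a\<close>,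
      so \<open>x\<close> dominates \<open>a\<close> times the indicator class, and \<xi>
      \<open>n x\<close> is at least \<open>a *\<close> \<delta> \<open>n\<close>.\<close>
    define a where "a = 1 / real (Suc m)"
    have "0 < a" by (simp add: a_def)
    have "A m \<inter> space Q = A m" by (auto simp: A_def space_Q)
    then have "(\<integral>\<omega>. indicat_real (A m) \<omega> \<partial>Q) = measure Q (A m)" by simp
    then have F: "indicat_real (A m) \<in> F n"
      using n A[of m] by (simp add: F_def indicator_le_1)
    have "qs (\<lambda>\<omega>. 0 \<le> f \<omega> + (- a) * indicat_real (A m) \<omega>)"
      by (rule quasi_surely_mono[OF f(4)]) (auto simp: A_def a_def indicator_def)
    moreover have mem: "cls f \<in> carrier B" "cls (indicat_real (A m)) \<in> carrier B"
      using f(3) FX[OF F] by auto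
    have eq: "cls f \<oplus>\<^bsub>B\<^esub> (- a) \<odot>\<^bsub>B\<^esub> cls (indicat_real (A m)) = cls (\<lambda>\<omega>. f \<omega> + (- a) * indicat_real (A m) \<omega>)"
      using f(1) by (simp add: B_simps)
    have "cls f \<oplus>\<^bsub>B\<^esub> (- a) \<odot>\<^bsub>B\<^esub> cls (indicat_real (A m)) \<in> carrier B"
      using mem plus_closed scale_closed by blast
    ultimately have "cls f \<oplus>\<^bsub>B\<^esub> (- a) \<odot>\<^bsub>B\<^esub> cls (indicat_real (A m)) \<in> pos_cone B"
      unfolding eq using f(1) by (simp add: pos_cone_B)
    then have "0 \<le> \<xi> n (cls f \<oplus>\<^bsub>B\<^esub> (- a) \<odot>\<^bsub>B\<^esub> cls (indicat_real (A m)))" by (rule pos)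
    also have "\<dots> = \<xi> n x - a * \<xi> n (cls (indicat_real (A m)))"
      using mem scale_closed[OF mem(2), of "- a"] f(2)
        lin_add[of "cls f" "(- a) \<odot>\<^bsub>B\<^esub> cls (indicat_real (A m))" n] lin_scale[of "cls (indicat_real (A m))" n "- a"]
      by simp
    finally have "a * \<delta> n \<le> \<xi> n x"
      using mult_left_mono[OF \<delta>_le[OF F], of a] \<open>0 < a\<close> by linarith
    then have "0 < \<xi> n x" using mult_pos_pos[OF \<open>0 < a\<close> \<delta>[of n]] by linarith
    \<comment> \<open>All terms of the series are nonnegative, and the one with index
      \<open>n\<close> is positive.\<close>
    then show ?thesis
      unfolding \<Xi>_def using f(2,3) pos[OF x(1)] by (intro suminf_pos2[of _ n] summable) auto
  qed
  moreover have "\<Xi> c \<le> 0" if "c \<in> C" for c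
  proof -
    have "(\<Sum>n. (1/2) ^ n * \<xi> n c) \<le> (\<Sum>n. 0 :: real)"
      using nonpos[OF that] coneD(1) that by (intro suminf_le summable) (auto simp: mult_nonneg_nonpos)
    then show ?thesis by (simp add: \<Xi>_def)
  qed
  moreover have "\<Xi> \<in> lcs.topological_dual"
    using cont add scale by (simp add: lcs.topological_dual_def)
  ultimately show ?thesis
    unfolding lcs.strictly_positive_def by (intro bexI[of _ \<Xi>]) auto
qed

end

text \<open>A dominating measure may charge quasi-surely null sets. Halmos-Savage, with this measure
  as \<mu>, replaces it by a probability measure \<open>Q\<close> whose null sets are exactly the
  quasi-surely null ones, so that integrals under \<open>Q\<close> depend only on the class.\<close>

lemma dominated_imp_kreps_yan:
  assumes "dominated M P"
  shows "locally_convex_solid.kreps_yan B (norm_topology B N)"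
proof -
  interpret lcs: locally_convex_solid B "norm_topology B N"
    by (rule locally_convex_solid_norm_topology)
  obtain Q' where Q': "Q' \<in> space (prob_algebra M)"
    "\<And>A. A \<in> sets M \<Longrightarrow> emeasure Q' A = 0 \<Longrightarrow> upper_prob P A = 0"
    using assms by (auto simp: dominated_def)
  interpret Q': prob_space Q' using Q' by (simp add: space_prob_algebra)
  have sets_Q': "sets Q' = sets M" using Q' by (simp add: space_prob_algebra)
  have "\<exists>Q\<in>space (prob_algebra M). \<forall>A\<in>sets M. emeasure Q A = 0 \<longleftrightarrow> upper_prob P A = 0"
  proof (rule Halmos_Savage[OF P_nonempty P_prob, of "measure Q'"])
    show "measure Q' (A \<union> A') = measure Q' A + measure Q' A'"
      if "A \<in> sets M" "A' \<in> sets M" "A \<inter> A' = {}" for A A'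
      using that by (intro Q'.finite_measure_Union) (auto simp: sets_Q')
    show "upper_prob P A = 0" if "A \<in> sets M" "measure Q' A = 0" for A
      using that Q'(2) by (simp add: Q'.emeasure_eq_measure)
  qed simp
  then obtain Q where Q: "Q \<in> space (prob_algebra M)"
    "\<And>A. A \<in> sets M \<Longrightarrow> emeasure Q A = 0 \<longleftrightarrow> upper_prob P A = 0" by blast
  show ?thesis
    unfolding lcs.kreps_yan_def using Kreps_Yan_functional[OF Q] by blast
qed

end

theorem corollary5p9:
  fixes M :: "'a measure"
    and P :: "'a measure set"
    and X :: "('a \<Rightarrow> real) set set"
    and N :: "('a \<Rightarrow> real) set \<Rightarrow> real"
  assumes "P \<noteq> {}" and "P \<subseteq> space (prob_algebra M)"
    and "lattice_ideal (L0 M P) X" and "Linfty M P \<subseteq> X"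
    and "banach_lattice (L0 M P\<lparr>carrier := X\<rparr>) N"
  shows "dominated M P \<longleftrightarrow>
    locally_convex_solid.kreps_yan (L0 M P\<lparr>carrier := X\<rparr>)
      (norm_topology (L0 M P\<lparr>carrier := X\<rparr>) N)"
proof -
  have "quasi_sure_banach_lattice M P X N"
    by (intro quasi_sure_banach_lattice.intro quasi_sure.intro
        quasi_sure_banach_lattice_axioms.intro assms)
  then show ?thesis
    using quasi_sure_banach_lattice.dominated_imp_kreps_yan
      quasi_sure_banach_lattice.kreps_yan_imp_dominated by blast
qed

end
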